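(* Let $n\ge 2$ and let $I$ be a proper subset of $[0,n-1]$, with $I_0$ the connected component of $I$ containing $0$ ($I_0=\emptyset$ if $0\notin I$). Put $\widetilde I=I$ if $I_0=\emptyset$, and $\widetilde I=(I\setminus\{0\})\cup\{1\}$ otherwise. Then $$\mathcal{D}_n^I(x)=f(x)\,C_{\widetilde I}\,\prod_{i=2\left\lfloor\frac{|I_0|+2}{2}\right\rfloor}^{n}\left(1+(-1)^{i-1}x^{\left\lfloor\frac{i}{2}\right\rfloor}\right)\prod_{j=2m_{\widetilde I}+2}^{n}\left(1+(-1)^{j-1}x^{\left\lfloor\frac{j}{2}\right\rfloor}\right),$$ where $$f(x)=\begin{cases}\dfrac{1+x^{|I_0|}+2x^{m_I}}{1+x^{m_I}}, & \text{if } |I_0|\ge 2,\ |I_0|\equiv 0\ (\mathrm{mod}\ 2),\ \text{and } n=2m_I,\\[2mm] 1+x^{|I_0|}, & \text{if } |I_0|\ge 2,\ |I_0|\equiv 0\ (\mathrm{mod}\ 2),\ \text{and } n>2m_I,\\[1mm] 1, & \text{otherwise.}\end{cases}$$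
   Context: For integers $a\le b$ let $[a,b]=\{a,a+1,\dots,b\}$, and $[a,b]=\emptyset$ if $a>b$; $[n]=[1,n]$. A signed permutation of degree $n$ is a bijection $\sigma$ of $\{\pm1,\dots,\pm n\}$ with $\sigma(-i)=-\sigma(i)$; $\mathcal{D}_n$ is the group of signed permutations of degree $n$ with an even number of negative entries among $\sigma(1),\dots,\sigma(n)$ (the Weyl group of type $D_n$). For $\sigma\in\mathcal{D}_n$, the Coxeter length is $\ell(\sigma)=|\{(i,j)\in[n]^2: i<j,\ \sigma(i)>\sigma(j)\}|+|\{(i,j)\in[n]^2: i<j,\ \sigma(i)+\sigma(j)<0\}|$, and the odd length is $L(\sigma)=|\{(i,j)\in[n]^2: i<j,\ \sigma(i)>\sigma(j),\ i\not\equiv j\ (\mathrm{mod}\ 2)\}|+|\{(i,j)\in[n]^2: i<j,\ \sigma(i)+\sigma(j)<0,\ i\not\equiv j\ (\mathrm{mod}\ 2)\}|$. For $I\subseteq[0,n-1]$, $\mathcal{D}_n^I=\{\sigma\in\mathcal{D}_n:\sigma(i)<\sigma(i+1)\text{ for all } i\in I\}$ with the convention $\sigma(0):=-\sigma(2)$, and $\mathcal{D}_n^I(x)=\sum_{\sigma\in\mathcal{D}_n^I}(-1)^{\ell(\sigma)}x^{L(\sigma)}$. Connected components: each $I\subseteq[0,n-1]$ is uniquely $I=I_0\cup I_1\cup\cdots\cup I_s$, where $I_0=[0,a_0-1]$ is the maximal interval of $I$ containing $0$ (with $I_0=\emptyset$, $|I_0|=0$ if $0\notin I$), and $I_1,\dots,I_s$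 are the other maximal intervals of consecutive integers in $I$, in increasing order. Set $m_I=\sum_{k=0}^s\left\lfloor\frac{|I_k|+1}{2}\right\rfloor$ and let $C_I=\left[\begin{matrix}m_I\\ \lfloor\frac{|I_0|+1}{2}\rfloor,\lfloor\frac{|I_1|+1}{2}\rfloor,\dots,\lfloor\frac{|I_s|+1}{2}\rfloor\end{matrix}\right]_{x^2}$ be the $q$-multinomial coefficient at $q=x^2$, where $\left[\begin{matrix}N\\ n_1,\dots,n_k\end{matrix}\right]_q=\frac{[N]_q!}{[n_1]_q!\cdots[n_k]_q!}$, $[N]_q!=\prod_{i=1}^N\frac{1-q^i}{1-q}$, $[0]_q!=1$. Quantities $m_{\widetilde I}$, $C_{\widetilde I}$ are computed from the connected components of $\widetilde I$. Empty products equal $1$. *)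

theory Defs
  imports
    "HOL-Combinatorics.Permutations"
    "HOL-Computational_Algebra.Polynomial_Factorial"
begin

text \<open>
  A signed permutation of degree \<open>n\<close> is a function on all integers fixing
  everything outside \<open>{-n..-1} \<union> {1..n}\<close>; in particular \<open>\<sigma> 0 = 0\<close> as a function. The convention
  \<open>\<sigma>(0) := -\<sigma>(2)\<close>, used only for descents, is implemented by \<open>ext0\<close>.
\<close>

definition signed_perms :: "nat \<Rightarrow> (int \<Rightarrow> int) set" where
  "signed_perms n =
     {\<sigma>. \<sigma> permutes ({- int n..-1} \<union> {1..int n}) \<and> (\<forall>i \<in> {- int n..-1} \<union> {1..int n}. \<sigma> (- i) = - \<sigma> i)}"

definition weyl_D :: "nat \<Rightarrow> (int \<Rightarrow> int) set" where
  "weyl_D n = {\<sigma> \<in> signed_perms n. even (card {i \<in> {1..int n}. \<sigma> i < 0})}"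

definition coxeter_length :: "nat \<Rightarrow> (int \<Rightarrow> int) \<Rightarrow> nat" where
  "coxeter_length n \<sigma> =
     card {(i, j) \<in> {1..int n} \<times> {1..int n}. i < j \<and> \<sigma> i > \<sigma> j} +
     card {(i, j) \<in> {1..int n} \<times> {1..int n}. i < j \<and> \<sigma> i + \<sigma> j < 0}"

definition odd_length :: "nat \<Rightarrow> (int \<Rightarrow> int) \<Rightarrow> nat" where
  "odd_length n \<sigma> =
     card {(i, j) \<in> {1..int n} \<times> {1..int n}. i < j \<and> \<sigma> i > \<sigma> j \<and> i mod 2 \<noteq> j mod 2} +
     card {(i, j) \<in> {1..int n} \<times> {1..int n}. i < j \<and> \<sigma> i + \<sigma> j < 0 \<and> i mod 2 \<noteq> j mod 2}"

definition ext0 :: "(int \<Rightarrow> int) \<Rightarrow> nat \<Rightarrow> int" where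
  "ext0 \<sigma> i = (if i = 0 then - \<sigma> 2 else \<sigma> (int i))"

definition D_quotient :: "nat \<Rightarrow> nat set \<Rightarrow> (int \<Rightarrow> int) set" where
  "D_quotient n I = {\<sigma> \<in> weyl_D n. \<forall>i\<in>I. ext0 \<sigma> i < ext0 \<sigma> (i + 1)}"

definition D_gen :: "nat \<Rightarrow> nat set \<Rightarrow> 'a::comm_ring_1 \<Rightarrow> 'a" where
  "D_gen n I x = (\<Sum>\<sigma>\<in>D_quotient n I. (- 1) ^ coxeter_length n \<sigma> * x ^ odd_length n \<sigma>)"

definition components :: "nat set \<Rightarrow> nat set set" where
  "components I =
     {J. J \<noteq> {} \<and> J \<subseteq> I \<and> (\<exists>a b. J = {a..b}) \<and>
         (\<forall>a b. J \<subseteq> {a..b} \<and> {a..b} \<subseteq> I \<longrightarrow> {a..b} = J)}"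

text \<open>The union has at most one member; it is empty when \<open>0 \<notin> I\<close>.\<close>

definition comp0 :: "nat set \<Rightarrow> nat set" where
  "comp0 I = \<Union>{J \<in> components I. 0 \<in> J}"

text \<open>
  Sums and products over \<open>components I\<close> run over the nonempty components only. An empty \<open>I\<^sub>0\<close>
  would contribute \<open>\<lfloor>1/2\<rfloor> = 0\<close> to \<open>m_idx\<close> and a factor \<open>[0]! = 1\<close> to \<open>C_idx\<close>.
\<close>

definition half_size :: "nat set \<Rightarrow> nat" where
  "half_size J = (card J + 1) div 2"

definition m_idx :: "nat set \<Rightarrow> nat" where
  "m_idx I = (\<Sum>J\<in>components I. half_size J)"

definition qfact :: "nat \<Rightarrow> 'a::field \<Rightarrow> 'a" where
  "qfact N q = (\<Prod>i=1..N. (1 - q ^ i) / (1 - q))"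

definition qmultinomial :: "nat \<Rightarrow> ('b \<Rightarrow> nat) \<Rightarrow> 'b set \<Rightarrow> 'a::field \<Rightarrow> 'a" where
  "qmultinomial N k A q = qfact N q / (\<Prod>a\<in>A. qfact (k a) q)"

definition C_idx :: "nat set \<Rightarrow> 'a::field \<Rightarrow> 'a" where
  "C_idx I x = qmultinomial (m_idx I) half_size (components I) (x\<^sup>2)"

definition tilde :: "nat set \<Rightarrow> nat set" where
  "tilde I = (if comp0 I = {} then I else (I - {0}) \<union> {1})"

definition f_factor :: "nat \<Rightarrow> nat set \<Rightarrow> 'a::field \<Rightarrow> 'a" where
  "f_factor n I x =
     (if card (comp0 I) \<ge> 2 \<and> even (card (comp0 I)) \<and> n = 2 * m_idx I
        then (1 + x ^ card (comp0 I) + 2 * x ^ m_idx I) / (1 + x ^ m_idx I)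
      else if card (comp0 I) \<ge> 2 \<and> even (card (comp0 I)) \<and> n > 2 * m_idx I
        then 1 + x ^ card (comp0 I)
      else 1)"

text \<open>
  The variable \<open>x\<close> is the indeterminate of the field of rational functions
  \<open>Frac(\<int>[x])\<close>, so that no denominator vanishes.
\<close>

definition indet :: "int poly fract" where
  "indet = to_fract [:0, 1:]"

end

theory Submission
  imports Defs
begin

text \<open>
  Give every position a colour (its parity) and weight a signed word by a factor \<open>-1\<close> or \<open>-x\<close> for
  each descent event of a pair of equally or differently coloured letters. Elements of the quotient
  become words that are increasing on blocks. If the last letter of a block is split off, sorting it
  back in yields a signed sum over its possible places; letting the letter carry its colour
  along, the insertions before and after a letter of the same colour cancel. On
  alternating colours at most two terms survive. The resulting linear relations among
  generating functions with slightly perturbed colourings reduce every composition to blocks of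
  sizes 1 and 2, let these blocks commute, and finally absorb them into the block of type D.
  When this block and all others have even size, the two relations for a block of size 2
  (\<open>gen_pair_solve\<close>) mix the two colourings, and this produces the exceptional factor \<open>f\<close>.
\<close>

section \<open>Weighted words with coloured positions\<close>

text \<open>Moving a letter shifts the positions of the letters it passes, and with them their
  parities, so the odd length itself obeys no simple insertion rule. With colours as independent
  labels a move costs one factor per letter passed, at the price of leaving the alternating
  colouring. Elimination works because a block of size 2 has just two alternating colourings, tied
  to two singletons by a linear system of determinant \<open>1 - x^2\<close>. This determinant is
  the denominator of the q-integers at \<open>q = x^2\<close>; hence the assumption
  \<open>x^k \<noteq> 1\<close>. Absorbing a pair into a type D block of odd size
  \<open>2 * h + 1\<close> gives \<open>(1 - x^(2*h+2))^2 / (1 - x^2)\<close>. One factor of the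
  square extends a q-factorial, the other is a product of two rank factors. Singletons left over
  give squared rank factors, so two products with different lower limits appear. All sums run over
  words with arbitrary signs and so give twice the type D value. If \<open>I\<close> contains 0 but
  not 1, a symmetry replaces it by \<open>tilde I\<close>, which avoids 0. If it contains both,
  \<open>|\<sigma>(1)| < \<sigma>(2)\<close> is forced and the first block is truly of type
  D.\<close>

definition desc_count :: "int \<Rightarrow> int \<Rightarrow> nat" where
  "desc_count a b = (if b < a then 1 else 0) + (if a + b < 0 then 1 else 0)"

definition signed_words :: "nat \<Rightarrow> int list set" where
  "signed_words n = {xs. distinct (map abs xs) \<and> set (map abs xs) = {1..int n}}"

fun blockwise_increasing :: "nat list \<Rightarrow> int list \<Rightarrow> bool" where
  "blockwise_increasing [] xs \<longleftrightarrow> xs = []"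
| "blockwise_increasing (n # ns) xs \<longleftrightarrow>
     (\<exists>ys zs. xs = ys @ zs \<and> length ys = n \<and> sorted_wrt (<) ys \<and> blockwise_increasing ns zs)"

text \<open>
  The first block carries the condition \<open>|\<sigma>(1)| < \<sigma>(2) < \<dots>\<close> of type D. Only its words with positive
  first letter are kept, since the sign of \<open>\<sigma>(1)\<close> influences neither the weight nor the condition.
\<close>

definition in_blocks :: "nat \<Rightarrow> nat list \<Rightarrow> int list \<Rightarrow> bool" where
  "in_blocks b ns xs \<longleftrightarrow> (\<exists>B zs. xs = B @ zs \<and> length B = b \<and> sorted_wrt (<) (0 # B) \<and>
     blockwise_increasing ns zs)"

definition block_words :: "nat \<Rightarrow> nat list \<Rightarrow> int list set" where
  "block_words b ns = {xs \<in> signed_words (b + sum_list ns). in_blocks b ns xs}"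

fun alt :: "bool \<Rightarrow> nat \<Rightarrow> bool list" where
  "alt c 0 = []"
| "alt c (Suc n) = c # alt (\<not> c) n"

lemma length_alt [simp]: "length (alt c n) = n"
  by (induction n arbitrary: c) auto

lemma alt_add: "alt c (m + n) = alt c m @ alt (if even m then c else \<not> c) n"
  by (induction m arbitrary: c) auto

lemma alt_even_append: "alt c (2 * h) @ alt c n = alt c (2 * h + n)"
  by (simp add: alt_add)

lemma map_Not_alt: "map Not (alt c n) = alt (\<not> c) n"
  by (induction n arbitrary: c) auto

lemma nth_alt: "i < n \<Longrightarrow> alt c n ! i = (if even i then c else \<not> c)"
  by (induction n arbitrary: c i) (auto simp: nth_Cons split: nat.split)

lemma length_signed_word:
  assumes "xs \<in> signed_words n"
  shows "length xs = n"
proof -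
  have "length xs = card (set (map abs xs))"
    using assms distinct_card[of "map abs xs"] by (simp add: signed_words_def del: set_map)
  then show ?thesis using assms by (simp add: signed_words_def del: set_map)
qed

lemma finite_signed_words: "finite (signed_words n)"
proof (rule finite_subset)
  show "signed_words n \<subseteq> {xs. set xs \<subseteq> {- int n..int n} \<and> length xs = n}"
  proof
    fix xs assume xs: "xs \<in> signed_words n"
    have "\<bar>y\<bar> \<in> {1..int n}" if "y \<in> set xs" for y
      using xs that by (auto simp: signed_words_def)
    then have "set xs \<subseteq> {- int n..int n}" by fastforce
    then show "xs \<in> {xs. set xs \<subseteq> {- int n..int n} \<and> length xs = n}"
      using length_signed_word[OF xs] by simp
  qed
  show "finite {xs. set xs \<subseteq> {- int n..int n} \<and> length xs = n}"
    by (rule finite_lists_length_eq) simp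
qed

lemma signed_words_mset_cong:
  assumes "mset (map abs xs) = mset (map abs ys)"
  shows "xs \<in> signed_words n \<longleftrightarrow> ys \<in> signed_words n"
  using assms mset_eq_imp_distinct_iff[OF assms] mset_eq_setD[OF assms]
  by (simp add: signed_words_def del: set_map)

lemma blockwise_increasing_length: "blockwise_increasing ns xs \<Longrightarrow> length xs = sum_list ns"
  by (induction ns arbitrary: xs) auto

lemma blockwise_increasing_append:
  "blockwise_increasing (ns @ ms) xs \<longleftrightarrow>
     (\<exists>ys zs. xs = ys @ zs \<and> blockwise_increasing ns ys \<and> blockwise_increasing ms zs)"
proof (induction ns arbitrary: xs)
  case (Cons n ns)
  show ?case (is "?l \<longleftrightarrow> ?r")
  proof
    assume ?l
    then obtain ys zs ts rs where "xs = ys @ ts @ rs" "length ys = n" "sorted_wrt (<) ys"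
      "blockwise_increasing ns ts" "blockwise_increasing ms rs"
      by (auto simp: Cons.IH)
    then show ?r
      by (intro exI[of _ "ys @ ts"] exI[of _ rs]) auto
  next
    assume ?r
    then obtain ys zs rs where "xs = (ys @ zs) @ rs" "length ys = n" "sorted_wrt (<) ys"
      "blockwise_increasing ns zs" "blockwise_increasing ms rs"
      by auto
    then show ?l
      unfolding append_Cons blockwise_increasing.simps Cons.IH by auto
  qed
qed simp

lemma in_blocks_length: "in_blocks b ns xs \<Longrightarrow> length xs = b + sum_list ns"
  by (auto simp: in_blocks_def dest: blockwise_increasing_length)

lemma in_blocks_append:
  "in_blocks b (ns @ ms) xs \<longleftrightarrow> (\<exists>P Z. xs = P @ Z \<and> in_blocks b ns P \<and> blockwise_increasing ms Z)"
  (is "?l \<longleftrightarrow> ?r")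
proof
  assume ?l
  then obtain B Z Y where "xs = (B @ Z) @ Y" "length B = b" "sorted_wrt (<) (0 # B)"
    "blockwise_increasing ns Z" "blockwise_increasing ms Y"
    unfolding in_blocks_def blockwise_increasing_append by force
  then show ?r unfolding in_blocks_def by blast
next
  assume ?r
  then obtain B Z Y where "xs = B @ (Z @ Y)" "length B = b" "sorted_wrt (<) (0 # B)"
    "blockwise_increasing (ns @ ms) (Z @ Y)"
    unfolding in_blocks_def blockwise_increasing_append by force
  then show ?l unfolding in_blocks_def by blast
qed

lemma in_blocks_block:
  "in_blocks b (ns1 @ k # ns2) xs \<longleftrightarrow>
     (\<exists>P T R. xs = P @ T @ R \<and> in_blocks b ns1 P \<and> length T = k \<and> sorted_wrt (<) T \<and>
        blockwise_increasing ns2 R)"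
  unfolding in_blocks_append blockwise_increasing.simps by blast

lemma blockwise_increasing_singleton:
  "blockwise_increasing (1 # ns) xs \<longleftrightarrow> (\<exists>y ys. xs = y # ys \<and> blockwise_increasing ns ys)"
proof
  assume "blockwise_increasing (1 # ns) xs"
  then show "\<exists>y ys. xs = y # ys \<and> blockwise_increasing ns ys"
    by (auto simp: length_Suc_conv)
next
  assume "\<exists>y ys. xs = y # ys \<and> blockwise_increasing ns ys"
  then obtain y ys where "xs = [y] @ ys" "blockwise_increasing ns ys" by auto
  then show "blockwise_increasing (1 # ns) xs"
    unfolding blockwise_increasing.simps by (intro exI[of _ "[y]"] exI[of _ ys]) simp
qed

lemma in_blocks_split:
  "in_blocks b (ns1 @ k # 1 # ns2) xs \<longleftrightarrow>
     (\<exists>P A y R. xs = P @ A @ y # R \<and> in_blocks b ns1 P \<and> length A = k \<and> sorted_wrt (<) A \<and>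
        blockwise_increasing ns2 R)"
  unfolding in_blocks_block blockwise_increasing_singleton by blast

lemma in_blocks_blockI:
  "in_blocks b ns1 P \<Longrightarrow> length T = k \<Longrightarrow> sorted_wrt (<) T \<Longrightarrow> blockwise_increasing ns2 R \<Longrightarrow>
     in_blocks b (ns1 @ k # ns2) (P @ T @ R)"
  unfolding in_blocks_block by blast

lemma in_blocks_splitI:
  "in_blocks b ns1 P \<Longrightarrow> length A = k \<Longrightarrow> sorted_wrt (<) A \<Longrightarrow> blockwise_increasing ns2 R \<Longrightarrow>
     in_blocks b (ns1 @ k # 1 # ns2) (P @ A @ y # R)"
  unfolding in_blocks_split by blast

context
  fixes x :: "'a::field"
begin

definition twist :: "bool \<Rightarrow> bool \<Rightarrow> 'a" where
  "twist c d = (if c = d then - 1 else - x)"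

definition pair_weight :: "bool \<times> int \<Rightarrow> bool \<times> int \<Rightarrow> 'a" where
  "pair_weight z w = twist (fst z) (fst w) ^ desc_count (snd z) (snd w)"

fun weight :: "(bool \<times> int) list \<Rightarrow> 'a" where
  "weight [] = 1"
| "weight (z # zs) = prod_list (map (pair_weight z) zs) * weight zs"

definition cross :: "(bool \<times> int) list \<Rightarrow> (bool \<times> int) list \<Rightarrow> 'a" where
  "cross A B = prod_list (map (\<lambda>z. prod_list (map (pair_weight z) B)) A)"

lemma cross_simps [simp]:
  "cross [] B = 1" "cross (z # A) B = prod_list (map (pair_weight z) B) * cross A B"
  "cross A [] = 1"
  "cross (A @ A') B = cross A B * cross A' B"
  by (induction A) (auto simp: cross_def)

lemma cross_append_right [simp]: "cross A (B @ B') = cross A B * cross A B'"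
  by (induction A) (auto simp: algebra_simps)

lemma cross_Cons_right: "cross A (z # B) = cross A [z] * cross A B"
  using cross_append_right[of A "[z]" B] by simp

lemma weight_append: "weight (A @ B) = weight A * weight B * cross A B"
  by (induction A) (auto simp: algebra_simps)

text \<open>Collects all factors that involve the middle segment \<open>M\<close>, so that two
  arrangements of \<open>M\<close> can be compared by \<open>weight M\<close> and its cross terms
  alone.\<close>

lemma weight_append3:
  "weight (A @ M @ R) = weight A * weight R * cross A R * (weight M * (cross A M * cross M R))"
  by (simp add: weight_append)

definition col_factor :: "bool \<Rightarrow> bool list \<Rightarrow> 'a" where
  "col_factor c A = prod_list (map (\<lambda>d. twist d c) A)"

lemma col_factor_simps [simp]: "col_factor c [] = 1" "col_factor c (d # A) = twist d c * col_factor c A"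
  "col_factor c (A @ B) = col_factor c A * col_factor c B"
  by (auto simp: col_factor_def)

text \<open>The event \<open>a + b < 0\<close> is symmetric in the two letters. Putting the smaller
  letter \<open>y\<close> behind a larger one therefore adds exactly one event, the inversion, and
  thus one \<open>twist\<close>.\<close>

lemma cross_singleton_smaller:
  assumes "length cV = length V" "\<And>v. v \<in> set V \<Longrightarrow> y < v"
  shows "cross (zip cV V) [(c, y)] = col_factor c cV * prod_list (map (pair_weight (c, y)) (zip cV V))"
  using assms
proof (induction cV V rule: list_induct2)
  case (Cons d cV v V)
  have "desc_count v y = Suc (desc_count y v)"
    using Cons.prems[of v] by (auto simp: desc_count_def)
  then have "pair_weight (d, v) (c, y) = twist d c * pair_weight (c, y) (d, v)"
    by (simp add: pair_weight_def twist_def)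
  with Cons show ?case by (simp add: algebra_simps)
qed simp

lemma weight_move_right:
  assumes "length cV = length V" "\<And>v. v \<in> set V \<Longrightarrow> y < v"
  shows "weight (A @ zip cV V @ (c, y) # R) = col_factor c cV * weight (A @ (c, y) # zip cV V @ R)"
proof -
  have "weight (zip cV V @ [(c, y)]) = col_factor c cV * weight ((c, y) # zip cV V)"
    using cross_singleton_smaller[OF assms, of c] by (simp add: weight_append algebra_simps)
  moreover have "cross B (zip cV V @ [(c, y)]) = cross B ((c, y) # zip cV V)"
    "cross (zip cV V @ [(c, y)]) B = cross ((c, y) # zip cV V) B" for B
    by (simp_all add: cross_Cons_right[of B _ "zip cV V"])
  ultimately show ?thesis
    using weight_append3[of A "zip cV V @ [(c, y)]" R] weight_append3[of A "(c, y) # zip cV V" R]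
    by simp
qed

lemma weight_map_Not: "weight (zip (map Not cs) xs) = weight (zip cs xs)"
proof (induction cs arbitrary: xs)
  case (Cons c cs)
  show ?case
  proof (cases xs)
    case (Cons y ys)
    have "map (pair_weight (\<not> c, y)) (zip (map Not cs) ys) = map (pair_weight (c, y)) (zip cs ys)"
      by (auto simp: zip_map1 pair_weight_def twist_def)
    then show ?thesis using Cons Cons.IH by simp
  qed simp
qed simp

definition gen :: "nat \<Rightarrow> nat list \<Rightarrow> bool list \<Rightarrow> 'a" where
  "gen b ns cs = (\<Sum>xs\<in>block_words b ns. weight (zip cs xs))"

text \<open>Weights see only whether two colours agree. This lets a colouring that starts with
  \<open>False\<close> be read as the standard one.\<close>

lemma gen_map_Not: "gen b ns (map Not cs) = gen b ns cs"
  by (simp add: gen_def weight_map_Not)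

end
section \<open>Inserting the last letter into a block\<close>

lemma sorted_filter_less:
  fixes y :: int
  assumes "sorted_wrt (<) (A :: int list)" "y \<notin> set A"
  shows "sorted_wrt (<) (filter (\<lambda>a. a < y) A @ y # filter (\<lambda>a. y < a) A)"
    "filter (\<lambda>a. a < y) A @ filter (\<lambda>a. y < a) A = A"
proof -
  have "filter (\<lambda>a. a < y) A @ filter (\<lambda>a. y < a) A = A"
    using assms
  proof (induction A)
    case (Cons a A)
    show ?case
    proof (cases "a < y")
      case False
      then have "y < a" using Cons.prems by auto
      moreover have "\<forall>b\<in>set A. y < b" using Cons.prems \<open>y < a\<close> by force
      then have "filter (\<lambda>a. a < y) A = []" "filter (\<lambda>a. y < a) A = A"
        by (auto simp: filter_empty_conv filter_id_conv)
      ultimately show ?thesis by simp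
    qed (use Cons in auto)
  qed simp
  then show "filter (\<lambda>a. a < y) A @ filter (\<lambda>a. y < a) A = A" .
  show "sorted_wrt (<) (filter (\<lambda>a. a < y) A @ y # filter (\<lambda>a. y < a) A)"
    using assms(1) by (auto simp: sorted_wrt_append intro: sorted_wrt_filter)
qed

lemma filter_less_sorted:
  fixes y :: int
  assumes "sorted_wrt (<) (U @ y # V)"
  shows "filter (\<lambda>a. a < y) (U @ V) = U" "filter (\<lambda>a. y < a) (U @ V) = V"
proof -
  have "\<forall>u\<in>set U. u < y" "\<forall>v\<in>set V. y < v"
    using assms by (auto simp: sorted_wrt_append)
  then have "filter (\<lambda>a. a < y) U = U" "filter (\<lambda>a. y < a) U = []"
    "filter (\<lambda>a. a < y) V = []" "filter (\<lambda>a. y < a) V = V"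
    by (force simp: filter_empty_conv filter_id_conv)+
  then show "filter (\<lambda>a. a < y) (U @ V) = U" "filter (\<lambda>a. y < a) (U @ V) = V" by simp_all
qed

text \<open>The index \<open>v\<close> counts the letters of the block of size \<open>k\<close> that
  are smaller than the singleton behind it. Sorting the singleton in makes it jump over the
  remaining letters, coloured \<open>drop v cA\<close>, and they pay
  \<open>col_factor\<close>.\<close>

lemma gen_split_last:
  assumes cP: "length cP = b + sum_list ns1" and cA: "length cA = k"
  shows "gen x b (ns1 @ k # 1 # ns2) (cP @ cA @ c # cR) =
    (\<Sum>v\<le>k. col_factor x c (drop v cA) *
       gen x b (ns1 @ Suc k # ns2) (cP @ take v cA @ c # drop v cA @ cR))"
proof -
  define n where "n = b + sum_list ns1 + Suc k + sum_list ns2"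
  define p where "p = b + sum_list ns1"
  define S where "S = block_words b (ns1 @ Suc k # ns2)"
  \<comment> \<open>\<open>j\<close> takes the letter at index \<open>v\<close> of the merged block,
    which starts at index \<open>p\<close>, and moves it to the block's end; \<open>i\<close> sorts
    it back in and records its place.\<close>
  define j :: "nat \<times> int list \<Rightarrow> int list" where
    "j = (\<lambda>(v, xs). take (p + v) xs @ take (k - v) (drop (Suc (p + v)) xs) @ xs ! (p + v) # drop (p + Suc k) xs)"
  define i :: "int list \<Rightarrow> nat \<times> int list" where
    "i = (\<lambda>ys. let A = take k (drop p ys); y = ys ! (p + k); U = filter (\<lambda>a. a < y) A in
       (length U, take p ys @ U @ y # filter (\<lambda>a. y < a) A @ drop (p + Suc k) ys))"
  define g where "g = (\<lambda>(v, xs). col_factor x c (drop v cA) *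
     weight x (zip (cP @ take v cA @ c # drop v cA @ cR) xs))"
  have merged: "\<exists>P U y V R. xs = P @ U @ y # V @ R \<and> length P = p \<and> length U = v \<and>
      length V = k - v \<and> v \<le> k \<and> xs \<in> signed_words n \<and>
      in_blocks b ns1 P \<and>
      sorted_wrt (<) (U @ y # V) \<and> blockwise_increasing ns2 R \<and>
      j (v, xs) = P @ U @ V @ y # R"
    if "(v, xs) \<in> {..k} \<times> S" for v xs
  proof -
    from that have "v \<le> k" "xs \<in> signed_words n" "in_blocks b (ns1 @ Suc k # ns2) xs"
      by (auto simp: S_def block_words_def n_def add.assoc)
    then obtain P T R where *: "xs = P @ T @ R" "length P = p" "length T = Suc k" "v \<le> k"
       "xs \<in> signed_words n"
       "in_blocks b ns1 P"
       "sorted_wrt (<) T" "blockwise_increasing ns2 R"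
      unfolding in_blocks_block p_def by (metis in_blocks_length)
    define U y V where "U = take v T" "y = T ! v" "V = drop (Suc v) T"
    then have "T = U @ y # V" "length U = v" "length V = k - v"
      using * id_take_nth_drop[of v T] by simp_all
    moreover from this have "j (v, xs) = P @ U @ V @ y # R"
      using * by (simp add: j_def nth_append Suc_diff_le)
    moreover have "xs = P @ U @ y # V @ R" using * calculation by simp
    ultimately show ?thesis using * by blast
  qed
  have split: "\<exists>P A y R. ys = P @ A @ y # R \<and> length P = p \<and> length A = k \<and>
      ys \<in> signed_words n \<and>
      in_blocks b ns1 P \<and>
      sorted_wrt (<) A \<and> blockwise_increasing ns2 R \<and>
      i ys = (length (filter (\<lambda>a. a < y) A), P @ filter (\<lambda>a. a < y) A @ y # filter (\<lambda>a. y < a) A @ R)"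
    if "ys \<in> block_words b (ns1 @ k # 1 # ns2)" for ys
  proof -
    from that have "ys \<in> signed_words n" "in_blocks b (ns1 @ k # 1 # ns2) ys"
      by (auto simp: block_words_def n_def add.assoc)
    then obtain P A y R where *: "ys = P @ A @ y # R" "length P = p" "length A = k"
      "ys \<in> signed_words n"
      "in_blocks b ns1 P"
      "sorted_wrt (<) A" "blockwise_increasing ns2 R"
      unfolding in_blocks_split p_def by (metis in_blocks_length)
    moreover have "i ys = (length (filter (\<lambda>a. a < y) A),
        P @ filter (\<lambda>a. a < y) A @ y # filter (\<lambda>a. y < a) A @ R)"
      using * by (simp add: i_def nth_append Let_def)
    ultimately show ?thesis by blast
  qed
  have "(\<Sum>v\<le>k. col_factor x c (drop v cA) *
       gen x b (ns1 @ Suc k # ns2) (cP @ take v cA @ c # drop v cA @ cR)) = sum g ({..k} \<times> S)"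
    by (simp add: gen_def g_def S_def sum_distrib_left sum.cartesian_product)
  also have "\<dots> = (\<Sum>ys\<in>block_words b (ns1 @ k # 1 # ns2). weight x (zip (cP @ cA @ c # cR) ys))"
  proof (rule sum.reindex_bij_witness[where i = i and j = j])
    fix a assume a: "a \<in> {..k} \<times> S"
    obtain v xs where vx: "a = (v, xs)" by force
    from merged[OF a[unfolded vx]] obtain P U y V R where *: "xs = P @ U @ y # V @ R" "length P = p"
      "length U = v" "length V = k - v" "v \<le> k"
      "xs \<in> signed_words n"
      "in_blocks b ns1 P"
      "sorted_wrt (<) (U @ y # V)" "blockwise_increasing ns2 R" "j (v, xs) = P @ U @ V @ y # R"
      by blast
    have sw: "P @ U @ V @ y # R \<in> signed_words n"
      using *(6) unfolding *(1) by (subst signed_words_mset_cong[where ys = "P @ U @ y # V @ R"]) auto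
    show "i (j a) = a"
      using * filter_less_sorted[OF *(8)] by (simp add: vx i_def nth_append Let_def)
    have "sorted_wrt (<) (U @ V)" using *(8) by (simp add: sorted_wrt_append)
    then show "j a \<in> block_words b (ns1 @ k # 1 # ns2)"
      using in_blocks_splitI[OF *(7), of "U @ V" k ns2 R y] * sw
      by (simp add: vx block_words_def n_def add.assoc)
    have "weight x (zip cP P @ zip (take v cA) U @ zip (drop v cA) V @ (c, y) # zip cR R) =
       col_factor x c (drop v cA) *
       weight x (zip cP P @ zip (take v cA) U @ (c, y) # zip (drop v cA) V @ zip cR R)"
      using weight_move_right[of "drop v cA" V y x "zip cP P @ zip (take v cA) U" c "zip cR R"] * cA
      by (auto simp: sorted_wrt_append)
    moreover have "zip (cP @ (take v cA @ drop v cA) @ c # cR) (P @ U @ V @ y # R) =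
        zip cP P @ zip (take v cA) U @ zip (drop v cA) V @ (c, y) # zip cR R"
      using * cP cA by (simp add: p_def del: append_take_drop_id)
    moreover have "zip (cP @ take v cA @ c # drop v cA @ cR) xs =
        zip cP P @ zip (take v cA) U @ (c, y) # zip (drop v cA) V @ zip cR R"
      using * cP cA by (simp add: p_def)
    ultimately show "weight x (zip (cP @ cA @ c # cR) (j a)) = g a"
      by (simp add: vx g_def *(10))
  next
    fix ys assume "ys \<in> block_words b (ns1 @ k # 1 # ns2)"
    from split[OF this] obtain P A y R where *: "ys = P @ A @ y # R" "length P = p" "length A = k"
      "ys \<in> signed_words n"
      "in_blocks b ns1 P"
      "sorted_wrt (<) A" "blockwise_increasing ns2 R"
      "i ys = (length (filter (\<lambda>a. a < y) A), P @ filter (\<lambda>a. a < y) A @ y # filter (\<lambda>a. y < a) A @ R)"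
      by blast
    define U V where UV: "U = filter (\<lambda>a. a < y) A" "V = filter (\<lambda>a. y < a) A"
    have "y \<notin> set A" using *(1,4) by (auto simp: signed_words_def)
    note A = sorted_filter_less[OF *(6) this, folded UV]
    have k: "length U + length V = k" using A(2) *(3) by auto
    have "j (i ys) = P @ U @ V @ y # R"
      using *(2) k by (auto simp: j_def *(8) UV[symmetric] nth_append)
    then show "j (i ys) = ys" using *(1) A(2) by simp
    have "P @ U @ y # V @ R \<in> signed_words n"
      using *(4) unfolding *(1) A(2)[symmetric]
      by (subst signed_words_mset_cong[where ys = "P @ (U @ V) @ y # R"]) auto
    then show "i ys \<in> {..k} \<times> S"
      using in_blocks_blockI[OF *(5), of "U @ y # V" "Suc k" ns2 R] A(1) *(7) k
      by (simp add: *(8) S_def block_words_def n_def add.assoc UV[symmetric])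
  qed
  also have "\<dots> = gen x b (ns1 @ k # 1 # ns2) (cP @ cA @ c # cR)"
    by (simp add: gen_def)
  finally show ?thesis by simp
qed

lemma in_blocks_singleton:
  "in_blocks b (1 # ns) xs \<longleftrightarrow> (\<exists>B y R. xs = B @ y # R \<and> length B = b \<and> sorted_wrt (<) (0 # B) \<and>
     blockwise_increasing ns R)"
  unfolding in_blocks_def blockwise_increasing_singleton by blast

lemma weight_positive_increasing:
  assumes "sorted_wrt (<) (0 # xs)" "length cs = length xs"
  shows "weight x (zip cs xs) = 1"
  using assms(2,1)
proof (induction cs xs rule: list_induct2)
  case (Cons c cs y ys)
  have "prod_list (map (pair_weight x (c, y)) zs) = 1" if "set zs \<subseteq> set (zip cs ys)" for zs
    using that
  proof (induction zs)
    case (Cons z zs)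
    then have "snd z \<in> set ys" by (metis in_set_zipE insert_subset list.simps(15) prod.collapse)
    then have "desc_count y (snd z) = 0"
      using \<open>sorted_wrt (<) (0 # y # ys)\<close> by (auto simp: desc_count_def)
    then show ?case using Cons by (simp add: pair_weight_def)
  qed simp
  then show ?case using Cons by simp
qed simp

lemma cross_singleton_const:
  assumes "length cU = length U" "\<And>u. u \<in> set U \<Longrightarrow> desc_count u y = e"
  shows "cross x (zip cU U) [(c, y)] = col_factor x c cU ^ e"
  using assms
  by (induction cU U rule: list_induct2) (auto simp: pair_weight_def power_mult_distrib)

text \<open>Negating the earlier letter \<open>a\<close> of a pair exchanges the events
  \<open>b < a\<close> and \<open>a + b < 0\<close>, so their number is unchanged.\<close>

lemma cross_abs_left:
  assumes "length cs = length xs" "map abs xs = map abs ys"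
  shows "cross x (zip cs xs) R = cross x (zip cs ys) R"
proof -
  have "length xs = length ys" using assms(2) by (metis length_map)
  with assms(1) show ?thesis
    using assms(2)
  proof (induction cs xs ys rule: list_induct3)
    case (Cons c cs y ys z zs)
    then have "y = z \<or> y = - z" by auto
    then have "pair_weight x (c, y) = pair_weight x (c, z)"
      by (auto simp: pair_weight_def desc_count_def fun_eq_iff)
    with Cons show ?case by simp
  qed simp
qed

text \<open>A larger letter \<open>v\<close> in front of \<open>y\<close> or \<open>- y\<close>
  gives one event, the inversion. A smaller positive letter gives none in front of \<open>y\<close>
  and both events in front of \<open>- y\<close>, hence the square. Later letters do not notice the
  sign, by \<open>cross_abs_left\<close>.\<close>

lemma weight_move_prefix:
  assumes "sorted_wrt (<) (0 # U @ y # V)" "length cU = length U" "length cV = length V"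
    and "s = 1 \<or> s = - 1"
  shows "weight x (zip cU U @ zip cV V @ (c, s * y) # R) =
    col_factor x c cV * (if s = 1 then 1 else (col_factor x c cU)\<^sup>2) *
    weight x (zip cU U @ (c, y) # zip cV V @ R)"
proof -
  have pos: "0 < y" "\<And>u. u \<in> set U \<Longrightarrow> 0 < u \<and> u < y" "\<And>v. v \<in> set V \<Longrightarrow> y < v"
    using assms(1) by (auto simp: sorted_wrt_append)
  have 1: "weight x (zip cU U @ (c, y) # zip cV V) = 1" "weight x (zip cU U @ zip cV V) = 1"
    using weight_positive_increasing[of "U @ y # V" "cU @ c # cV" x]
      weight_positive_increasing[of "U @ V" "cU @ cV" x] assms
    by (auto simp: sorted_wrt_append)
  have "desc_count v (s * y) = 1" if "v \<in> set V" for v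
    using assms(4) pos(1) pos(3)[OF that] by (auto simp: desc_count_def)
  then have "cross x (zip cV V) [(c, s * y)] = col_factor x c cV ^ 1"
    by (intro cross_singleton_const assms)
  moreover have "desc_count u (s * y) = (if s = 1 then 0 else 2)" if "u \<in> set U" for u
    using assms(4) pos(1) pos(2)[OF that] by (auto simp: desc_count_def)
  then have "cross x (zip cU U) [(c, s * y)] = col_factor x c cU ^ (if s = 1 then 0 else 2)"
    by (intro cross_singleton_const assms)
  ultimately have 2: "weight x ((zip cU U @ zip cV V) @ [(c, s * y)]) =
      col_factor x c cV * (if s = 1 then 1 else (col_factor x c cU)\<^sup>2)"
    using weight_append[of x "zip cU U @ zip cV V" "[(c, s * y)]"] 1(2) by (simp add: mult.commute)
  have "cross x [(c, s * y)] R = cross x [(c, y)] R"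
    using cross_abs_left[of "[c]" "[s * y]" "[y]" x R] assms(4) by auto
  then have 3: "cross x ((zip cU U @ zip cV V) @ [(c, s * y)]) R = cross x (zip cU U @ (c, y) # zip cV V) R"
    by (simp add: mult_ac)
  show ?thesis
    using weight_append[of x "(zip cU U @ zip cV V) @ [(c, s * y)]" R]
      weight_append[of x "zip cU U @ (c, y) # zip cV V" R]
    by (simp only: 1 2 3) simp
qed

text \<open>Letters of the first block are positive, so a following singleton is sorted in by its
  absolute value. The two summands of \<open>1 + (col_factor x c (take v cA))^2\<close> belong to
  its two possible signs.\<close>

lemma gen_insert_prefix:
  assumes cA: "length cA = b"
  shows "gen x b (1 # ns) (cA @ c # cR) =
    (\<Sum>v\<le>b. col_factor x c (drop v cA) * (1 + (col_factor x c (take v cA))\<^sup>2) *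
       gen x (Suc b) ns (take v cA @ c # drop v cA @ cR))"
proof -
  define n where "n = Suc b + sum_list ns"
  define S where "S = block_words (Suc b) ns"
  define j :: "(int \<times> nat) \<times> int list \<Rightarrow> int list" where
    "j = (\<lambda>((s, v), xs). take v xs @ take (b - v) (drop (Suc v) xs) @ (s * xs ! v) # drop (Suc b) xs)"
  \<comment> \<open>The sign is lost on insertion and is therefore kept as a separate component; it
    is \<open>1\<close> or \<open>- 1\<close> because letters are nonzero.\<close>
  define i :: "int list \<Rightarrow> (int \<times> nat) \<times> int list" where
    "i = (\<lambda>ys. let A = take b ys; y = \<bar>ys ! b\<bar>; U = filter (\<lambda>a. a < y) A in
       ((sgn (ys ! b), length U), U @ y # filter (\<lambda>a. y < a) A @ drop (Suc b) ys))"
  define g where "g = (\<lambda>((s :: int, v), xs). col_factor x c (drop v cA) *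
     (if s = 1 then 1 else (col_factor x c (take v cA))\<^sup>2) *
     weight x (zip (take v cA @ c # drop v cA @ cR) xs))"
  have merged: "\<exists>U y V R. xs = U @ y # V @ R \<and> length U = v \<and>
      length V = b - v \<and> v \<le> b \<and> (s = 1 \<or> s = - 1) \<and> xs \<in> signed_words n \<and>
      sorted_wrt (<) (0 # U @ y # V) \<and> blockwise_increasing ns R \<and>
      j ((s, v), xs) = U @ V @ (s * y) # R"
    if "((s, v), xs) \<in> ({1, - 1 :: int} \<times> {..b}) \<times> S" for s v xs
  proof -
    from that have "v \<le> b" "s = 1 \<or> s = - 1" "xs \<in> signed_words n" "in_blocks (Suc b) ns xs"
      by (auto simp: S_def block_words_def n_def add.assoc)
    then obtain T R where *: "xs = T @ R" "length T = Suc b" "v \<le> b" "s = 1 \<or> s = - 1"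
       "xs \<in> signed_words n" "sorted_wrt (<) (0 # T)" "blockwise_increasing ns R"
      unfolding in_blocks_def by blast
    define U y V where "U = take v T" "y = T ! v" "V = drop (Suc v) T"
    then have "T = U @ y # V" "length U = v" "length V = b - v"
      using * id_take_nth_drop[of v T] by simp_all
    moreover from this have "j ((s, v), xs) = U @ V @ (s * y) # R"
      using * by (simp add: j_def nth_append Suc_diff_le)
    moreover have "xs = U @ y # V @ R" using * calculation by simp
    ultimately show ?thesis using * by blast
  qed
  have split: "\<exists>A y R. ys = A @ y # R \<and> length A = b \<and> ys \<in> signed_words n \<and>
      sorted_wrt (<) (0 # A) \<and> blockwise_increasing ns R \<and>
      i ys = ((sgn y, length (filter (\<lambda>a. a < \<bar>y\<bar>) A)),
        filter (\<lambda>a. a < \<bar>y\<bar>) A @ \<bar>y\<bar> # filter (\<lambda>a. \<bar>y\<bar> < a) A @ R)"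
    if "ys \<in> block_words b (1 # ns)" for ys
  proof -
    from that have "ys \<in> signed_words n" "in_blocks b (1 # ns) ys"
      by (auto simp: block_words_def n_def add.assoc)
    then obtain A y R where *: "ys = A @ y # R" "length A = b" "ys \<in> signed_words n"
      "sorted_wrt (<) (0 # A)" "blockwise_increasing ns R"
      unfolding in_blocks_singleton by blast
    moreover have "i ys = ((sgn y, length (filter (\<lambda>a. a < \<bar>y\<bar>) A)),
        filter (\<lambda>a. a < \<bar>y\<bar>) A @ \<bar>y\<bar> # filter (\<lambda>a. \<bar>y\<bar> < a) A @ R)"
      using * by (simp add: i_def nth_append Let_def)
    ultimately show ?thesis by blast
  qed
  have "(\<Sum>v\<le>b. col_factor x c (drop v cA) * (1 + (col_factor x c (take v cA))\<^sup>2) *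
       gen x (Suc b) ns (take v cA @ c # drop v cA @ cR)) =
     (\<Sum>s\<in>{1, - 1 :: int}. \<Sum>v\<le>b. col_factor x c (drop v cA) *
       (if s = (1 :: int) then 1 else (col_factor x c (take v cA))\<^sup>2) *
       gen x (Suc b) ns (take v cA @ c # drop v cA @ cR))"
    by (simp add: sum.distrib algebra_simps)
  also have "\<dots> = (\<Sum>sv\<in>{1, - 1 :: int} \<times> {..b}. \<Sum>xs\<in>S. g (sv, xs))"
    by (subst sum.cartesian_product, rule sum.cong)
      (auto simp: g_def gen_def S_def sum_distrib_left)
  also have "\<dots> = sum g (({1, - 1 :: int} \<times> {..b}) \<times> S)"
    by (simp add: sum.cartesian_product split_def)
  also have "\<dots> = (\<Sum>ys\<in>block_words b (1 # ns). weight x (zip (cA @ c # cR) ys))"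
  proof (rule sum.reindex_bij_witness[where i = i and j = j])
    fix a assume a: "a \<in> ({1, - 1 :: int} \<times> {..b}) \<times> S"
    obtain s v xs where vx: "a = ((s, v), xs)" by (metis prod.collapse)
    from merged[OF a[unfolded vx]] obtain U y V R where *: "xs = U @ y # V @ R"
      "length U = v" "length V = b - v" "v \<le> b" "s = 1 \<or> s = - 1" "xs \<in> signed_words n"
      "sorted_wrt (<) (0 # U @ y # V)" "blockwise_increasing ns R"
      "j ((s, v), xs) = U @ V @ (s * y) # R"
      by blast
    have "abs (s * y) = abs y" using *(5) by auto
    then have sw: "U @ V @ (s * y) # R \<in> signed_words n"
      using *(6) unfolding *(1) by (subst signed_words_mset_cong[where ys = "U @ y # V @ R"]) auto
    have y: "0 < y" "sorted_wrt (<) (U @ y # V)" "sorted_wrt (<) (0 # U @ V)"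
      using *(7) by (auto simp: sorted_wrt_append)
    show "i (j a) = a"
      using * filter_less_sorted[OF y(2)] y(1)
      by (auto simp: vx i_def nth_append Let_def simp del: filter_append)
    have "in_blocks b (1 # ns) (U @ V @ (s * y) # R)"
      unfolding in_blocks_singleton using y(3) * by (intro exI[of _ "U @ V"]) auto
    then show "j a \<in> block_words b (1 # ns)"
      using sw * by (simp add: vx block_words_def n_def add.assoc)
    have "weight x (zip (take v cA) U @ zip (drop v cA) V @ (c, s * y) # zip cR R) =
       col_factor x c (drop v cA) * (if s = 1 then 1 else (col_factor x c (take v cA))\<^sup>2) *
       weight x (zip (take v cA) U @ (c, y) # zip (drop v cA) V @ zip cR R)"
      by (rule weight_move_prefix) (use * cA in auto)
    moreover have "zip ((take v cA @ drop v cA) @ c # cR) (U @ V @ (s * y) # R) =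
        zip (take v cA) U @ zip (drop v cA) V @ (c, s * y) # zip cR R"
      using * cA by (simp del: append_take_drop_id)
    moreover have "zip (take v cA @ c # drop v cA @ cR) xs =
        zip (take v cA) U @ (c, y) # zip (drop v cA) V @ zip cR R"
      using * cA by simp
    ultimately show "weight x (zip (cA @ c # cR) (j a)) = g a"
      by (simp add: vx g_def *(9))
  next
    fix ys assume "ys \<in> block_words b (1 # ns)"
    from split[OF this] obtain A y R where *: "ys = A @ y # R" "length A = b" "ys \<in> signed_words n"
      "sorted_wrt (<) (0 # A)" "blockwise_increasing ns R"
      "i ys = ((sgn y, length (filter (\<lambda>a. a < \<bar>y\<bar>) A)),
        filter (\<lambda>a. a < \<bar>y\<bar>) A @ \<bar>y\<bar> # filter (\<lambda>a. \<bar>y\<bar> < a) A @ R)"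
      by blast
    define U V where UV: "U = filter (\<lambda>a. a < \<bar>y\<bar>) A" "V = filter (\<lambda>a. \<bar>y\<bar> < a) A"
    have "\<bar>y\<bar> \<notin> abs ` set A" "\<bar>y\<bar> \<in> {1..int n}"
      using *(1,3) by (auto simp: signed_words_def)
    moreover have "abs ` set A = set A" using *(4) by (force simp: image_iff)
    ultimately have y: "\<bar>y\<bar> \<notin> set A" "y \<noteq> 0" by auto
    have A0: "sorted_wrt (<) A" using *(4) by simp
    note A = sorted_filter_less[OF A0 y(1), folded UV]
    have k: "length U + length V = b" using A(2) *(2) by auto
    have "j (i ys) = U @ V @ (sgn y * \<bar>y\<bar>) # R"
      using k by (auto simp: j_def *(6) UV[symmetric] nth_append)
    then show "j (i ys) = ys" using *(1) A(2) by (simp add: sgn_mult_abs)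
    have "U @ \<bar>y\<bar> # V @ R \<in> signed_words n"
      using *(3) unfolding *(1) A(2)[symmetric]
      by (subst signed_words_mset_cong[where ys = "(U @ V) @ y # R"]) auto
    moreover have "in_blocks (Suc b) ns (U @ \<bar>y\<bar> # V @ R)"
      unfolding in_blocks_def using A(1) *(4,5) k y
      by (intro exI[of _ "U @ \<bar>y\<bar> # V"] exI[of _ R]) (auto simp: UV)
    moreover have "sgn y = 1 \<or> sgn y = - 1" using y by (auto simp: sgn_if)
    ultimately show "i ys \<in> ({1, - 1 :: int} \<times> {..b}) \<times> S"
      using k by (auto simp: *(6) S_def block_words_def n_def add.assoc UV[symmetric])
  qed
  also have "\<dots> = gen x b (1 # ns) (cA @ c # cR)"
    by (simp add: gen_def)
  finally show ?thesis by simp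
qed

section \<open>Cancellation of insertions on alternating colours\<close>

definition insertion_sum :: "'a::field \<Rightarrow> bool \<Rightarrow> (bool list \<Rightarrow> bool list \<Rightarrow> 'a) \<Rightarrow> bool list \<Rightarrow> 'a" where
  "insertion_sum x c G A = (\<Sum>v\<le>length A. col_factor x c (drop v A) * G (take v A) (drop v A))"

lemma insertion_sum_Nil [simp]: "insertion_sum x c G [] = G [] []"
  by (simp add: insertion_sum_def)

lemma insertion_sum_Cons [simp]:
  "insertion_sum x c G (d # A) =
     twist x d c * col_factor x c A * G [] (d # A) + insertion_sum x c (\<lambda>L. G (d # L)) A"
  unfolding insertion_sum_def list.size(4) add_Suc_right add_0_right Suc_eq_plus1[symmetric]
  by (subst sum.atMost_Suc_shift) simp

text \<open>Two consecutive letters of different colours contribute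
  \<open>(- 1) * (- x) = x\<close>.\<close>

lemma col_factor_alt_even: "col_factor x c (alt d (2 * h)) = x ^ h"
proof (induction h)
  case (Suc h)
  then show ?case by (cases "d = c") (auto simp: twist_def)
qed simp

text \<open>The hypothesis says that the places just before and just after a letter of colour
  \<open>c\<close> give the same colouring; their coefficients differ by
  \<open>twist c c = - 1\<close>. Here the places 0 and 1, 2 and 3, and so on cancel, and the last
  one is left over. Keeping \<open>G\<close> abstract covers ordinary blocks and the type D block at
  once.\<close>

lemma insertion_sum_alt_same:
  assumes "\<And>L R. G (L @ [c]) R = G L (c # R)"
  shows "insertion_sum x c G (alt c (2 * h)) = G (alt c (2 * h)) []"
  using assms
proof (induction h arbitrary: G)
  case (Suc h)
  have "insertion_sum x c (\<lambda>L. G (c # (\<not> c) # L)) (alt c (2 * h)) = G (c # (\<not> c) # alt c (2 * h)) []"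
    by (rule Suc.IH) (metis Suc.prems append_Cons)
  moreover have "G [c] R = G [] (c # R)" for R
    using Suc.prems[of "[]"] by simp
  ultimately show ?case by (simp add: twist_def)
qed simp

text \<open>With an odd number of letters the places are even in number and all pair off.\<close>

lemma insertion_sum_alt_same_odd:
  assumes "\<And>L R. G (L @ [c]) R = G L (c # R)"
  shows "insertion_sum x c G (alt c (Suc (2 * h))) = 0"
  using assms
proof (induction h arbitrary: G)
  case 0
  then show ?case using 0[of "[]"] by (simp add: twist_def)
next
  case (Suc h)
  have "insertion_sum x c (\<lambda>L. G (c # (\<not> c) # L)) (alt c (Suc (2 * h))) = 0"
    by (rule Suc.IH) (metis Suc.prems append_Cons)
  moreover have "G [c] R = G [] (c # R)" for R
    using Suc.prems[of "[]"] by simp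
  ultimately show ?case by (simp add: twist_def)
qed

text \<open>The pairing is shifted by one: the places 1 and 2, 3 and 4, and so on cancel, which
  leaves place 0 at the cost of passing the whole block.\<close>

lemma insertion_sum_alt_other:
  assumes "\<And>L R. G (L @ [c]) R = G L (c # R)"
  shows "insertion_sum x c G (alt (\<not> c) (2 * h)) = x ^ h * G [] (alt (\<not> c) (2 * h))"
proof (cases h)
  case (Suc k)
  have "insertion_sum x c (\<lambda>L. G ((\<not> c) # L)) (alt c (Suc (2 * k))) = 0"
    by (rule insertion_sum_alt_same_odd) (metis assms append_Cons)
  moreover have "alt (\<not> c) (2 * h) = (\<not> c) # alt c (Suc (2 * k))"
    using Suc by simp
  ultimately show ?thesis
    using col_factor_alt_even[of x c "\<not> c" h]
    by (simp only: insertion_sum_Cons col_factor_simps) simp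
qed simp

text \<open>Both extreme places survive. Passing the whole block costs
  \<open>(- x)^(h+1) * (- 1)^h\<close>.\<close>

lemma insertion_sum_alt_other_odd:
  assumes "\<And>L R. G (L @ [c]) R = G L (c # R)"
  shows "insertion_sum x c G (alt (\<not> c) (Suc (2 * h))) =
    G (alt (\<not> c) (Suc (2 * h))) [] - x ^ Suc h * G [] (alt (\<not> c) (Suc (2 * h)))"
proof -
  have "insertion_sum x c (\<lambda>L. G ((\<not> c) # L)) (alt c (2 * h)) = G ((\<not> c) # alt c (2 * h)) []"
    by (rule insertion_sum_alt_same) (metis assms append_Cons)
  then show ?thesis
    by (simp add: col_factor_alt_even twist_def)
qed

lemma alt_snoc: "alt c (2 * h) @ [c] = alt c (Suc (2 * h))" "alt c (Suc (2 * h)) @ [\<not> c] = alt c (2 * h + 2)"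
  using alt_add[of c "2 * h" 1] alt_add[of c "Suc (2 * h)" 1] by simp_all

lemma alt_snoc_append: "alt c (2 * h) @ c # cR = alt c (Suc (2 * h)) @ cR"
  "alt c (Suc (2 * h)) @ (\<not> c) # cR = alt c (2 * h + 2) @ cR"
  using alt_snoc[of c h] by (metis append_Cons append_Nil append_assoc)+

lemma alt_odd_append: "alt c (Suc (2 * h)) @ alt (\<not> c) n = alt c (Suc (2 * h) + n)"
  using alt_add[of c "Suc (2 * h)" n] by simp

lemma alt_even_append2: "alt c (2 * h) @ alt c n @ R = alt c (2 * h + n) @ R"
  by (simp flip: alt_even_append)

lemma alt_odd_append2: "alt c (Suc (2 * h)) @ alt (\<not> c) n @ R = alt c (Suc (2 * h) + n) @ R"
  using alt_odd_append[of c h n] by (metis append_assoc)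

lemma alt_2: "alt c 2 = [c, \<not> c]" and alt_3: "alt c 3 = [c, \<not> c, c]"
  by (simp_all add: numeral_eq_Suc)

section \<open>Relations for adjoining a singleton to a block\<close>

context
  fixes x :: "'a::field"
begin

lemma gen_insertion_sum:
  assumes "length cP = b + sum_list ns1" "length cA = k"
  shows "gen x b (ns1 @ k # 1 # ns2) (cP @ cA @ c # cR) =
    insertion_sum x c (\<lambda>L R. gen x b (ns1 @ Suc k # ns2) (cP @ L @ c # R @ cR)) cA"
  using gen_split_last[OF assms, of x ns2 c cR] assms by (simp add: insertion_sum_def)

lemma gen_insertion_sum_prefix:
  assumes "length cA = b"
  shows "gen x b (1 # ns) (cA @ c # cR) =
    insertion_sum x c (\<lambda>L R. (1 + (col_factor x c L)\<^sup>2) * gen x (Suc b) ns (L @ c # R @ cR)) cA"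
  using gen_insert_prefix[OF assms, of x ns c cR] assms by (simp add: insertion_sum_def mult.assoc)

lemma gen_append_same:
  assumes "length cP = b + sum_list ns1"
  shows "gen x b (ns1 @ (2 * h) # 1 # ns2) (cP @ alt c (2 * h) @ c # cR) =
    gen x b (ns1 @ Suc (2 * h) # ns2) (cP @ alt c (Suc (2 * h)) @ cR)"
  by (subst gen_insertion_sum[OF assms], simp, subst insertion_sum_alt_same)
    (simp_all add: alt_snoc_append del: alt.simps)

text \<open>The letter moves to the front of the block, where it makes the colours alternate again:
  a block with the wrong phase is repaired at the cost \<open>x^h\<close>.\<close>

lemma gen_append_other:
  assumes "length cP = b + sum_list ns1"
  shows "gen x b (ns1 @ (2 * h) # 1 # ns2) (cP @ alt (\<not> c) (2 * h) @ c # cR) =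
    x ^ h * gen x b (ns1 @ Suc (2 * h) # ns2) (cP @ alt c (Suc (2 * h)) @ cR)"
  by (subst gen_insertion_sum[OF assms], simp, subst insertion_sum_alt_other) simp_all

lemma gen_append_same_odd:
  assumes "length cP = b + sum_list ns1"
  shows "gen x b (ns1 @ Suc (2 * h) # 1 # ns2) (cP @ alt c (Suc (2 * h)) @ c # cR) = 0"
  by (subst gen_insertion_sum[OF assms], simp, subst insertion_sum_alt_same_odd) simp_all

lemma gen_append_other_odd:
  assumes "length cP = b + sum_list ns1"
  shows "gen x b (ns1 @ Suc (2 * h) # 1 # ns2) (cP @ alt c (Suc (2 * h)) @ (\<not> c) # cR) =
    gen x b (ns1 @ (2 * h + 2) # ns2) (cP @ alt c (2 * h + 2) @ cR) -
    x ^ Suc h * gen x b (ns1 @ (2 * h + 2) # ns2) (cP @ alt (\<not> c) (2 * h + 2) @ cR)"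
proof -
  let ?G = "\<lambda>L R. gen x b (ns1 @ Suc (Suc (2 * h)) # ns2) (cP @ L @ (\<not> c) # R @ cR)"
  have "insertion_sum x (\<not> c) ?G (alt c (Suc (2 * h))) =
      ?G (alt c (Suc (2 * h))) [] - x ^ Suc h * ?G [] (alt c (Suc (2 * h)))"
    using insertion_sum_alt_other_odd[of ?G "\<not> c" x h] by (simp del: alt.simps)
  moreover have "(\<not> c) # alt c (Suc (2 * h)) @ cR = alt (\<not> c) (2 * h + 2) @ cR" by simp
  ultimately show ?thesis
    using gen_insertion_sum[OF assms, of "alt c (Suc (2 * h))" "Suc (2 * h)" ns2 "\<not> c" cR]
    by (simp only: length_alt alt_snoc_append append_Nil add_2_eq_Suc')
qed

text \<open>The surviving place is the end, so a negative letter passes the entire block with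
  squared factor \<open>(x^h)^2\<close>.\<close>

lemma gen_prefix_same:
  "gen x (2 * h) (1 # ns) (alt c (2 * h) @ c # cR) =
    (1 + x ^ (2 * h)) * gen x (Suc (2 * h)) ns (alt c (Suc (2 * h)) @ cR)"
  by (subst gen_insertion_sum_prefix, simp, subst insertion_sum_alt_same)
    (simp_all add: twist_def alt_snoc_append col_factor_alt_even power_mult_distrib power_mult
      mult.commute[of h] flip: power_mult del: alt.simps)

text \<open>The surviving place is the front, where no smaller letter remains and both signs count
  equally; hence the 2.\<close>

lemma gen_prefix_other:
  "gen x (2 * h) (1 # ns) (alt (\<not> c) (2 * h) @ c # cR) =
    2 * x ^ h * gen x (Suc (2 * h)) ns (alt c (Suc (2 * h)) @ cR)"
  by (subst gen_insertion_sum_prefix, simp, subst insertion_sum_alt_other)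
    (simp_all add: twist_def)

lemma gen_prefix_same_odd:
  "gen x (Suc (2 * h)) (1 # ns) (alt c (Suc (2 * h)) @ c # cR) = 0"
  by (subst gen_insertion_sum_prefix, simp, subst insertion_sum_alt_same_odd)
    (simp_all add: twist_def)

lemma gen_prefix_other_odd:
  "gen x (Suc (2 * h)) (1 # ns) (alt c (Suc (2 * h)) @ (\<not> c) # cR) =
    (1 + x ^ (2 * h + 2)) * gen x (2 * h + 2) ns (alt c (2 * h + 2) @ cR) -
    2 * x ^ Suc h * gen x (2 * h + 2) ns (alt (\<not> c) (2 * h + 2) @ cR)"
proof -
  let ?G = "\<lambda>L R. (1 + (col_factor x (\<not> c) L)\<^sup>2) * gen x (Suc (Suc (2 * h))) ns (L @ (\<not> c) # R @ cR)"
  \<comment> \<open>Of the letters, \<open>h + 1\<close> differ in colour from the inserted one and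
    \<open>h\<close> agree with it.\<close>
  have "(col_factor x (\<not> c) (alt c (Suc (2 * h))))\<^sup>2 = x ^ (2 * h + 2)"
    by (simp add: col_factor_alt_even twist_def power2_eq_square) (simp add: mult_ac, simp add: mult_2_right power_add)
  moreover have "insertion_sum x (\<not> c) ?G (alt c (Suc (2 * h))) =
      ?G (alt c (Suc (2 * h))) [] - x ^ Suc h * ?G [] (alt c (Suc (2 * h)))"
    using insertion_sum_alt_other_odd[of ?G "\<not> c" x h] by (simp add: twist_def del: alt.simps)
  moreover have "(\<not> c) # alt c (Suc (2 * h)) @ cR = alt (\<not> c) (2 * h + 2) @ cR" by simp
  ultimately show ?thesis
    using gen_insertion_sum_prefix[of "alt c (Suc (2 * h))" "Suc (2 * h)" ns "\<not> c" cR]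
    by (simp only: length_alt alt_snoc_append append_Nil add_2_eq_Suc' col_factor_simps) simp
qed

end
section \<open>Evaluation for compositions\<close>

definition pieces :: "nat \<Rightarrow> nat list" where
  "pieces k = replicate (k div 2) 2 @ (if odd k then [1] else [])"

lemma sum_list_pieces: "sum_list (concat (map pieces ns)) = sum_list ns"
  by (induction ns) (auto simp: pieces_def sum_list_replicate elim!: oddE)

lemma count_pieces:
  "count_list (concat (map pieces ns)) 2 = (\<Sum>k\<leftarrow>ns. k div 2)"
  "count_list (concat (map pieces ns)) 1 = (\<Sum>k\<leftarrow>ns. k mod 2)"
proof -
  have "count_list (replicate n a) b = (if a = b then n else 0)" for n and a b :: nat
    by (induction n) auto
  then show "count_list (concat (map pieces ns)) 2 = (\<Sum>k\<leftarrow>ns. k div 2)"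
    "count_list (concat (map pieces ns)) 1 = (\<Sum>k\<leftarrow>ns. k mod 2)"
    by (induction ns) (auto simp: pieces_def mod2_eq_if)
qed

lemma set_pieces: "set (concat (map pieces ns)) \<subseteq> {1, 2}"
  by (auto simp: pieces_def split: if_splits)

lemma block_words_Nil: "block_words n [] = {[1..int n]}"
proof -
  have pos: "map abs xs = xs" if "sorted_wrt (<) (0 # xs)" for xs :: "int list"
    using that by (intro map_idI) auto
  have "xs = [1..int n]" if "xs \<in> block_words n []" for xs
  proof -
    from that have xs: "xs \<in> signed_words n" "sorted_wrt (<) (0 # xs)"
      by (auto simp: block_words_def in_blocks_def)
    then have "set xs = {1..int n}"
      using pos[of xs] by (auto simp: signed_words_def simp del: set_map)
    moreover have "sorted xs" "distinct xs"
      using xs by (auto simp: strict_sorted_iff)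
    ultimately show ?thesis
      by (intro sorted_distinct_set_unique) auto
  qed
  moreover have sorted: "sorted_wrt (<) (0 # [1..int n])" by (auto simp: sorted_upto)
  then have "[1..int n] \<in> block_words n []"
    using pos[OF sorted] by (simp add: block_words_def in_blocks_def signed_words_def del: set_map)
  ultimately show ?thesis by blast
qed

definition rank_factor :: "'a::comm_ring_1 \<Rightarrow> nat \<Rightarrow> 'a" where
  "rank_factor x i = 1 + (- 1) ^ (i - 1) * x ^ (i div 2)"

lemma rank_factor_pair:
  "rank_factor x (2 * h + 2) = 1 - x ^ Suc h" "rank_factor x (2 * h + 3) = 1 + x ^ Suc h"
  by (auto simp: rank_factor_def)

text \<open>The factors at \<open>2 * h + 2\<close> and \<open>2 * h + 3\<close> are
  \<open>1 - x^(h+1)\<close> and \<open>1 + x^(h+1)\<close>. Their product is the numerator of the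
  q-integer of \<open>h + 1\<close> at \<open>q = x^2\<close>, which ties these products to
  q-factorials.\<close>

lemma prod_rank_factor_pair:
  assumes "2 * h + 3 \<le> n"
  shows "(\<Prod>i = 2 * h + 2..n. rank_factor x i) =
    (1 - x ^ (2 * h + 2)) * (\<Prod>i = 2 * Suc h + 2..n. rank_factor x i)"
proof -
  have e: "Suc (2 * h + 2) = 2 * h + 3" "Suc (2 * h + 3) = 2 * Suc h + 2" by simp_all
  have "(\<Prod>i = 2 * h + 2..n. rank_factor x i) =
      rank_factor x (2 * h + 2) * (rank_factor x (2 * h + 3) * (\<Prod>i = 2 * Suc h + 2..n. rank_factor x i))"
    using assms prod.atLeast_Suc_atMost[of "2 * h + 2" n "rank_factor x", unfolded e]
      prod.atLeast_Suc_atMost[of "2 * h + 3" n "rank_factor x", unfolded e]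
    by simp
  also have "\<dots> = (1 - x ^ (2 * h + 2)) * (\<Prod>i = 2 * Suc h + 2..n. rank_factor x i)"
    unfolding rank_factor_pair by (simp add: algebra_simps mult_2_right power_add)
  finally show ?thesis .
qed
definition gen0 :: "'a::field \<Rightarrow> nat \<Rightarrow> nat list \<Rightarrow> 'a" where
  "gen0 x b ns = gen x b ns (alt True (b + sum_list ns))"

section \<open>Reduction to pairs and singletons\<close>

context
  fixes x :: "'a::field"
  assumes power_neq_1: "\<And>k. 0 < k \<Longrightarrow> x ^ k \<noteq> 1"
begin

lemma square_neq_1: "1 - x\<^sup>2 \<noteq> 0"
  using power_neq_1[of 2] by simp

lemma gen_pair_expand:
  assumes "length cP = b + sum_list ns1"
  shows "gen x b (ns1 @ 1 # 1 # ns2) (cP @ c # (\<not> c) # cR) =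
    gen x b (ns1 @ 2 # ns2) (cP @ alt c 2 @ cR) - x * gen x b (ns1 @ 2 # ns2) (cP @ alt (\<not> c) 2 @ cR)"
  using gen_append_other_odd[OF assms, of x 0 ns2 c cR] by (simp add: alt_2 numeral_2_eq_2)

lemma gen_pair_same:
  assumes "length cP = b + sum_list ns1"
  shows "gen x b (ns1 @ 1 # 1 # ns2) (cP @ c # c # cR) = 0"
  using gen_append_same_odd[OF assms, of x 0 ns2 c cR] by simp

text \<open>Inverts the system given by \<open>gen_pair_expand\<close> for \<open>c\<close> and for
  \<open>\<not> c\<close>, with matrix rows \<open>(1, - x)\<close> and
  \<open>(- x, 1)\<close>.\<close>

lemma gen_pair_solve:
  assumes "length cP = b + sum_list ns1"
  shows "(1 - x\<^sup>2) * gen x b (ns1 @ 2 # ns2) (cP @ alt c 2 @ cR) =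
    gen x b (ns1 @ 1 # 1 # ns2) (cP @ c # (\<not> c) # cR) +
    x * gen x b (ns1 @ 1 # 1 # ns2) (cP @ (\<not> c) # c # cR)"
proof -
  have "gen x b (ns1 @ 1 # 1 # ns2) (cP @ (\<not> c) # c # cR) =
      gen x b (ns1 @ 2 # ns2) (cP @ alt (\<not> c) 2 @ cR) - x * gen x b (ns1 @ 2 # ns2) (cP @ alt c 2 @ cR)"
    using gen_pair_expand[OF assms, of ns2 "\<not> c" cR] by simp
  then show ?thesis
    by (simp only: gen_pair_expand[OF assms]) (simp add: algebra_simps power2_eq_square)
qed

text \<open>The pair is split by \<open>gen_pair_solve\<close>, and its letters are appended to the
  block of size \<open>2 * h\<close> one at a time, in both colour orders. The terms in
  \<open>E (\<not> c)\<close> cancel; what remains is the q-integer of \<open>h + 1\<close> at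
  \<open>q = x^2\<close>.\<close>

lemma gen_merge_pair:
  assumes "length cP = b + sum_list ns1"
  shows "(1 - x\<^sup>2) * gen x b (ns1 @ (2 * h) # 2 # ns2) (cP @ alt c (2 * h + 2) @ cR) =
    (1 - x ^ (2 * h + 2)) * gen x b (ns1 @ (2 * h + 2) # ns2) (cP @ alt c (2 * h + 2) @ cR)"
proof -
  have l: "length (cP @ alt c (2 * h)) = b + sum_list (ns1 @ [2 * h])" for c
    using assms by simp
  define E where "E c = gen x b (ns1 @ (2 * h + 2) # ns2) (cP @ alt c (2 * h + 2) @ cR)" for c
  have 1: "gen x b (ns1 @ (2 * h) # 1 # 1 # ns2) (cP @ alt c (2 * h) @ c # (\<not> c) # cR) =
      E c - x ^ Suc h * E (\<not> c)"
    using gen_append_same[OF assms, of x h "1 # ns2" c "(\<not> c) # cR"]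
      gen_append_other_odd[OF assms, of x h ns2 c cR] by (simp only: E_def)
  have 2: "gen x b (ns1 @ (2 * h) # 1 # 1 # ns2) (cP @ alt c (2 * h) @ (\<not> c) # c # cR) =
      x ^ h * (E (\<not> c) - x ^ Suc h * E c)"
    using gen_append_other[OF assms, of x h "1 # ns2" "\<not> c" "c # cR"]
      gen_append_other_odd[OF assms, of x h ns2 "\<not> c" cR] by (simp only: E_def not_not)
  have "(1 - x\<^sup>2) * gen x b (ns1 @ (2 * h) # 2 # ns2) (cP @ alt c (2 * h) @ alt c 2 @ cR) =
      (E c - x ^ Suc h * E (\<not> c)) + x * (x ^ h * (E (\<not> c) - x ^ Suc h * E c))"
    using gen_pair_solve[OF l[of c], of ns2 c cR] 1 2 by (simp del: alt.simps)
  also have "\<dots> = (1 - x ^ (2 * h + 2)) * E c"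
    by (simp add: algebra_simps mult_2_right power_add)
  finally show ?thesis
    by (simp only: E_def alt_even_append2)
qed

text \<open>Three singletons coloured \<open>c, \<not> c, c\<close> are merged in two ways. Joining
  the first two gives \<open>(1 - x^2) * T\<close>, where \<open>T\<close> belongs to one block of
  size 3; joining the last two gives \<open>1 - x^2\<close> times the value for sizes 1, 2. The
  second relation expresses that adjacent equally coloured singletons give 0.\<close>

lemma gen_swap:
  assumes "length cP = b + sum_list ns1"
  shows "gen x b (ns1 @ 1 # 2 # ns2) (cP @ alt c 3 @ cR) = gen x b (ns1 @ 2 # 1 # ns2) (cP @ alt c 3 @ cR)"
    and "gen x b (ns1 @ 1 # 2 # ns2) (cP @ c # alt c 2 @ cR) =
      x * gen x b (ns1 @ 1 # 2 # ns2) (cP @ alt c 3 @ cR)"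
proof -
  have l: "length (cP @ [c]) = b + sum_list (ns1 @ [1])"
    using assms by simp
  define T where "T = gen x b (ns1 @ 3 # ns2) (cP @ alt c 3 @ cR)"
  note a3 = alt_2 alt_3
  have n21: "gen x b (ns1 @ 2 # 1 # ns2) (cP @ alt c 3 @ cR) = T"
    using gen_append_same[OF assms, of x 1 ns2 c cR] by (simp add: T_def a3 numeral_3_eq_3)
  have m21: "gen x b (ns1 @ 2 # 1 # ns2) (cP @ alt (\<not> c) 2 @ c # cR) = x * T"
    using gen_append_other[OF assms, of x 1 ns2 c cR] by (simp add: T_def a3 numeral_3_eq_3)
  have m111: "gen x b (ns1 @ 1 # 1 # 1 # ns2) (cP @ c # (\<not> c) # c # cR) = T - x * (x * T)"
    using gen_pair_expand[OF assms, of "1 # ns2" c "c # cR"] n21 m21 by (simp add: a3)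
  show 2: "gen x b (ns1 @ 1 # 2 # ns2) (cP @ c # alt c 2 @ cR) =
      x * gen x b (ns1 @ 1 # 2 # ns2) (cP @ alt c 3 @ cR)"
    using gen_pair_expand[OF l, of ns2 c cR] gen_pair_same[OF assms, of "1 # ns2" c "(\<not> c) # cR"]
    by (simp add: a3)
  have "gen x b (ns1 @ 1 # 2 # ns2) (cP @ alt c 3 @ cR) - x * gen x b (ns1 @ 1 # 2 # ns2) (cP @ c # alt c 2 @ cR)
      = T - x * (x * T)"
    using gen_pair_expand[OF l, of ns2 "\<not> c" cR] m111 by (simp add: a3)
  then have "(1 - x\<^sup>2) * gen x b (ns1 @ 1 # 2 # ns2) (cP @ alt c 3 @ cR) = (1 - x\<^sup>2) * T"
    unfolding 2 by (simp add: algebra_simps power2_eq_square)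
  then show "gen x b (ns1 @ 1 # 2 # ns2) (cP @ alt c 3 @ cR) = gen x b (ns1 @ 2 # 1 # ns2) (cP @ alt c 3 @ cR)"
    using square_neq_1 n21 by simp
qed

lemma qfact_Suc: "(1 - x\<^sup>2) * qfact (Suc N) (x\<^sup>2) = (1 - x ^ (2 * N + 2)) * qfact N (x\<^sup>2)"
proof -
  have "qfact (Suc N) (x\<^sup>2) = qfact N (x\<^sup>2) * ((1 - (x\<^sup>2) ^ Suc N) / (1 - x\<^sup>2))"
    by (simp add: qfact_def)
  also have "(x\<^sup>2) ^ Suc N = x ^ (2 * N + 2)"
    using power_mult[of x 2 "Suc N"] by (simp only: mult_Suc_right add.commute)
  finally have "qfact (Suc N) (x\<^sup>2) = qfact N (x\<^sup>2) * ((1 - x ^ (2 * N + 2)) / (1 - x\<^sup>2))" .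
  moreover have "d * (q * (p / d)) = p * q" if "d \<noteq> 0" for d p q :: 'a
    using that by simp
  ultimately show ?thesis using square_neq_1 by metis
qed

lemma gen_merge_pairs:
  assumes "length cP = b + sum_list ns1"
  shows "gen x b (ns1 @ replicate h 2 @ ns2) (cP @ alt c (2 * h) @ cR) =
    qfact h (x\<^sup>2) * gen x b (ns1 @ (2 * h) # ns2) (cP @ alt c (2 * h) @ cR)"
proof (induction h arbitrary: ns2 cR)
  case 0
  have "blockwise_increasing (ns1 @ 0 # ns2) = blockwise_increasing (ns1 @ ns2)"
    by (intro ext) (simp add: blockwise_increasing_append)
  then show ?case
    by (simp add: qfact_def gen_def block_words_def in_blocks_def)
next
  case (Suc h)
  have "gen x b (ns1 @ replicate (Suc h) 2 @ ns2) (cP @ alt c (2 * Suc h) @ cR) =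
      gen x b (ns1 @ replicate h 2 @ (2 # ns2)) (cP @ alt c (2 * h) @ (alt c 2 @ cR))"
    using alt_even_append[of c h 2]
    by (simp add: replicate_app_Cons_same del: alt.simps flip: append_assoc)
  also have "\<dots> = qfact h (x\<^sup>2) * gen x b (ns1 @ (2 * h) # 2 # ns2) (cP @ alt c (2 * h + 2) @ cR)"
    by (subst Suc.IH) (simp only: alt_even_append2)
  finally have "(1 - x\<^sup>2) * gen x b (ns1 @ replicate (Suc h) 2 @ ns2) (cP @ alt c (2 * Suc h) @ cR) =
      qfact h (x\<^sup>2) * ((1 - x\<^sup>2) * gen x b (ns1 @ (2 * h) # 2 # ns2) (cP @ alt c (2 * h + 2) @ cR))"
    by simp
  also have "\<dots> = (1 - x\<^sup>2) * (qfact (Suc h) (x\<^sup>2) *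
      gen x b (ns1 @ (2 * Suc h) # ns2) (cP @ alt c (2 * Suc h) @ cR))"
    by (subst gen_merge_pair[OF assms]) (simp add: qfact_Suc flip: mult.assoc del: alt.simps)
  finally show ?case using square_neq_1 by simp
qed

text \<open>A singleton whose colour repeats at the start of the next pair can be exchanged with
  that pair at the cost \<open>x\<close>. It then meets the following pair in the same
  situation.\<close>

lemma gen_move_singleton:
  assumes "length cP = b + sum_list ns1"
  shows "gen x b (ns1 @ 1 # replicate r 2 @ ns2) (cP @ c # alt c (2 * r) @ cR) =
    x ^ r * gen x b (ns1 @ 1 # replicate r 2 @ ns2) (cP @ alt c (2 * r + 1) @ cR)"
  using assms
proof (induction r arbitrary: cP ns1)
  case (Suc r)
  have l: "length (cP @ [c, \<not> c]) = b + sum_list (ns1 @ [2])"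
    using Suc.prems by simp
  note a = alt_2 alt_3
  have "gen x b (ns1 @ 1 # 2 # replicate r 2 @ ns2) (cP @ c # alt c 2 @ (alt c (2 * r) @ cR)) =
      x * gen x b (ns1 @ 2 # 1 # replicate r 2 @ ns2) (cP @ alt c 3 @ (alt c (2 * r) @ cR))"
    using gen_swap[OF Suc.prems] by simp
  also have "\<dots> = x * (x ^ r * gen x b (ns1 @ 2 # 1 # replicate r 2 @ ns2) (cP @ [c, \<not> c] @ alt c (2 * r + 1) @ cR))"
    using Suc.IH[OF l] by (simp add: a)
  also have "gen x b (ns1 @ 2 # 1 # replicate r 2 @ ns2) (cP @ [c, \<not> c] @ alt c (2 * r + 1) @ cR) =
     gen x b (ns1 @ 1 # 2 # replicate r 2 @ ns2) (cP @ alt c (2 * Suc r + 1) @ cR)"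
    using gen_swap(1)[OF Suc.prems, of "replicate r 2 @ ns2" c "alt (\<not> c) (2 * r) @ cR"] by (simp add: a)
  finally show ?case by (simp add: a)
qed simp

text \<open>The pairs merge into a block of even size with factor \<open>qfact\<close>; the last
  letter of an odd block is in phase and is adjoined without any factor.\<close>

lemma gen_pieces:
  assumes "length cP = b + sum_list ns1"
  shows "gen x b (ns1 @ pieces k @ ns2) (cP @ alt c k @ cR) =
    qfact (k div 2) (x\<^sup>2) * gen x b (ns1 @ k # ns2) (cP @ alt c k @ cR)"
proof (cases "even k")
  case True
  then obtain h where "k = 2 * h" by blast
  then show ?thesis
    using gen_merge_pairs[OF assms, of h ns2 c cR] by (simp add: pieces_def)
next
  case False
  then obtain h where k: "k = Suc (2 * h)" by (metis oddE Suc_eq_plus1)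
  then show ?thesis
    using gen_merge_pairs[OF assms, of h "1 # ns2" c "c # cR"]
      gen_append_same[OF assms, of x h ns2 c cR]
    by (simp add: pieces_def alt_snoc_append del: alt.simps)
qed

lemma gen_normalize:
  assumes "length cP = b + sum_list ns1"
  shows "gen x b (ns1 @ concat (map pieces ns)) (cP @ alt c (sum_list ns)) =
    (\<Prod>k\<leftarrow>ns. qfact (k div 2) (x\<^sup>2)) * gen x b (ns1 @ ns) (cP @ alt c (sum_list ns))"
  using assms
proof (induction ns arbitrary: ns1 cP c)
  case (Cons k ns)
  define d where "d = (if even k then c else \<not> c)"
  have l: "length (cP @ alt c k) = b + sum_list (ns1 @ [k])" using Cons.prems by simp
  have a: "alt c (sum_list (k # ns)) = alt c k @ alt d (sum_list ns)"
    by (simp add: alt_add d_def)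
  show ?case
    unfolding a using gen_pieces[OF Cons.prems, of k "concat (map pieces ns)" c "alt d (sum_list ns)"]
      Cons.IH[OF l, of d] by (simp add: mult.assoc)
qed simp

lemma gen_bubble:
  assumes "length cP = b + sum_list ns1"
  shows "gen x b (ns1 @ 1 # replicate r 2 @ ns2) (cP @ alt c (2 * r + 1) @ cR) =
    gen x b (ns1 @ replicate r 2 @ 1 # ns2) (cP @ alt c (2 * r + 1) @ cR)"
  using assms
proof (induction r arbitrary: cP ns1)
  case (Suc r)
  have l: "length (cP @ [c, \<not> c]) = b + sum_list (ns1 @ [2])"
    using Suc.prems by simp
  show ?case
    using gen_swap(1)[OF Suc.prems, of "replicate r 2 @ ns2" c "alt (\<not> c) (2 * r) @ cR"] Suc.IH[OF l]
    by (simp add: alt_3)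
qed simp

lemma gen_sort:
  assumes "length cP = b + sum_list ns1" "set ns \<subseteq> {1, 2}"
  shows "gen x b (ns1 @ ns) (cP @ alt c (sum_list ns)) =
    gen x b (ns1 @ replicate (count_list ns 2) 2 @ replicate (count_list ns 1) 1) (cP @ alt c (sum_list ns))"
  using assms
proof (induction ns arbitrary: ns1 cP c)
  case (Cons k ns)
  define m t where "m = count_list ns 2" "t = count_list ns 1"
  have s: "sum_list ns = 2 * m + t"
    using Cons.prems(2) unfolding m_t_def by (induction ns) auto
  from Cons.prems(2) consider "k = 2" | "k = 1" by auto
  then show ?case
  proof cases
    case 1
    have l: "length (cP @ [c, \<not> c]) = b + sum_list (ns1 @ [2])"
      using Cons.prems by simp
    show ?thesis
      using Cons.IH[OF l, of c] Cons.prems(2) 1 by simp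
  next
    case 2
    have l: "length (cP @ [c]) = b + sum_list (ns1 @ [1])"
      using Cons.prems by simp
    have "alt c (Suc (sum_list ns)) = alt c (2 * m + 1) @ alt (\<not> c) t"
      using alt_odd_append[of c m t] by (simp add: s)
    then show ?thesis
      using Cons.IH[OF l, of "\<not> c"] Cons.prems(2) 2
        gen_bubble[OF Cons.prems(1), of m "replicate t 1" c "alt (\<not> c) t"]
      by (simp add: m_t_def)
  qed
qed simp

text \<open>Up to q-factorials, only the numbers of pairs and singletons matter. These q-factorials
  become the denominator of the multinomial coefficient, and the number of pairs enters
  \<open>m_idx\<close>.\<close>

lemma gen0_normalize:
  "(\<Prod>k\<leftarrow>ns. qfact (k div 2) (x\<^sup>2)) * gen0 x b ns =
     gen0 x b (replicate (\<Sum>k\<leftarrow>ns. k div 2) 2 @ replicate (\<Sum>k\<leftarrow>ns. k mod 2) 1)"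
proof -
  \<comment> \<open>The phase of the colouring right after the first block, written in the
    unsimplified form that \<open>alt_add\<close> produces.\<close>
  define c where "c = (if even b then True else \<not> True)"
  have l: "length (alt True b) = b + sum_list []" by simp
  have "2 * (\<Sum>k\<leftarrow>ns. k div 2) + (\<Sum>k\<leftarrow>ns. k mod 2) = sum_list ns"
    by (induction ns) (auto simp: algebra_simps)
  then have s: "sum_list (replicate (\<Sum>k\<leftarrow>ns. k div 2) 2 @ replicate (\<Sum>k\<leftarrow>ns. k mod 2) 1) = sum_list ns"
    by (simp add: sum_list_replicate mult.commute)
  show ?thesis
    using gen_normalize[OF l, of ns c] gen_sort[OF l set_pieces, of ns c]
    unfolding gen0_def s by (simp add: alt_add c_def sum_list_pieces count_pieces[simplified])
qed

lemma gen0_bubble: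
  "gen0 x b (1 # replicate r 2 @ replicate t 1) = gen0 x b (replicate r 2 @ 1 # replicate t 1)"
proof -
  define c where "c = (if even b then True else \<not> True)"
  have l: "length (alt True b) = b + sum_list []" by simp
  have "alt True (b + (2 * r + 1 + t)) = alt True b @ alt c (2 * r + 1) @ alt (\<not> c) t"
    using alt_odd_append[of c r t] by (simp only: alt_add[of True b] c_def Suc_eq_plus1)
  then show ?thesis
    using gen_bubble[OF l, of r "replicate t 1" c "alt (\<not> c) t"]
    by (simp add: gen0_def sum_list_replicate mult.commute[of r] add_ac)
qed

lemma gen0_Nil: "gen x n [] (alt c n) = 1"
proof -
  have "sorted_wrt (<) (0 # [1..int n])" by (auto simp: sorted_upto)
  then show ?thesis
    by (simp add: gen_def block_words_Nil weight_positive_increasing)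
qed

section \<open>Absorption into the type D block\<close>

text \<open>The first singleton leaves an even block in both phases, and the second turns both into
  the same odd block. The coefficients combine to \<open>(1 + q)^2 - 4 * q = (1 - q)^2\<close> with
  \<open>q = x^(2*h+2)\<close>.\<close>

lemma gen_odd_singletons:
  "gen x (Suc (2 * h)) (1 # 1 # ns) (alt c (Suc (2 * Suc h)) @ cR) =
    (1 - x ^ (2 * h + 2))\<^sup>2 * gen x (Suc (2 * Suc h)) ns (alt c (Suc (2 * Suc h)) @ cR)"
proof -
  have e: "2 * h + 2 = 2 * Suc h" and "Suc (2 * Suc h) = Suc (2 * h) + 2" by simp_all
  then have "alt c (Suc (2 * Suc h)) @ cR = alt c (Suc (2 * h)) @ (\<not> c) # c # cR"
    by (simp only: alt_odd_append2[symmetric] alt_2 append_Cons append_Nil not_not)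
  moreover have "gen x (2 * h + 2) (1 # ns) (alt c (2 * h + 2) @ c # cR) =
      (1 + x ^ (2 * h + 2)) * gen x (Suc (2 * Suc h)) ns (alt c (Suc (2 * Suc h)) @ cR)"
    unfolding e by (rule gen_prefix_same)
  moreover have "gen x (2 * h + 2) (1 # ns) (alt (\<not> c) (2 * h + 2) @ c # cR) =
      2 * x ^ Suc h * gen x (Suc (2 * Suc h)) ns (alt c (Suc (2 * Suc h)) @ cR)"
    unfolding e by (rule gen_prefix_other)
  ultimately have "gen x (Suc (2 * h)) (1 # 1 # ns) (alt c (Suc (2 * Suc h)) @ cR) =
    ((1 + x ^ (2 * h + 2))\<^sup>2 - (2 * x ^ Suc h)\<^sup>2) * gen x (Suc (2 * Suc h)) ns (alt c (Suc (2 * Suc h)) @ cR)"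
    using gen_prefix_other_odd[of x h "1 # ns" c "c # cR"]
    by (simp only: left_diff_distrib power2_eq_square mult.assoc)
  also have "(1 + x ^ (2 * h + 2))\<^sup>2 - (2 * x ^ Suc h)\<^sup>2 = (1 - x ^ (2 * h + 2))\<^sup>2"
    by (simp add: algebra_simps power2_eq_square mult_2_right power_add)
  finally show ?thesis .
qed

text \<open>In \<open>gen_pair_solve\<close> the order that puts a letter of colour \<open>c\<close>
  right behind the odd block vanishes by \<open>gen_prefix_same_odd\<close>, so a pair acts like two
  singletons divided by \<open>1 - x^2\<close>.\<close>

lemma gen_odd_pair:
  "(1 - x\<^sup>2) * gen x (Suc (2 * h)) (2 # ns) (alt c (Suc (2 * Suc h)) @ cR) =
    (1 - x ^ (2 * h + 2))\<^sup>2 * gen x (Suc (2 * Suc h)) ns (alt c (Suc (2 * Suc h)) @ cR)"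
proof -
  have l: "length (alt c (Suc (2 * h))) = Suc (2 * h) + sum_list []" by simp
  have "Suc (2 * Suc h) = Suc (2 * h) + 2" by simp
  then have a: "alt c (Suc (2 * Suc h)) @ cR = alt c (Suc (2 * h)) @ alt (\<not> c) 2 @ cR"
    "alt c (Suc (2 * Suc h)) @ cR = alt c (Suc (2 * h)) @ (\<not> c) # c # cR"
    by (simp_all only: alt_odd_append2[symmetric] alt_2 append_Cons append_Nil not_not)
  have "(1 - x\<^sup>2) * gen x (Suc (2 * h)) (2 # ns) (alt c (Suc (2 * h)) @ alt (\<not> c) 2 @ cR) =
      gen x (Suc (2 * h)) (1 # 1 # ns) (alt c (Suc (2 * h)) @ (\<not> c) # c # cR)"
    using gen_pair_solve[OF l, of ns "\<not> c" cR] gen_prefix_same_odd[of x h "1 # ns" c "(\<not> c) # cR"]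
    by (simp only: append_Nil not_not mult_zero_right add_0_right)
  then show ?thesis
    unfolding gen_odd_singletons[symmetric] a[symmetric] .
qed

text \<open>The induction proceeds by two singletons, since only then is the block odd again. For a
  single last one, both terms of \<open>gen_prefix_other_odd\<close> concern the identity word, and
  \<open>1 + x^(2*h+2) - 2 * x^(h+1)\<close> is a square.\<close>

lemma gen0_odd_singletons:
  "gen0 x (Suc (2 * h)) (replicate t 1) = (\<Prod>i = 2 * h + 2..2 * h + 1 + t. rank_factor x i)\<^sup>2"
proof (induction t arbitrary: h rule: induct_nat_012)
  case 0
  show ?case by (simp add: gen0_def gen0_Nil del: alt.simps)
next
  case 1
  have "gen0 x (Suc (2 * h)) [1] = 1 + x ^ (2 * h + 2) - 2 * x ^ Suc h"
    using gen_prefix_other_odd[of x h "[]" True "[]"] alt_snoc[of True h]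
    by (simp add: gen0_def gen0_Nil del: alt.simps)
  also have "\<dots> = (rank_factor x (2 * h + 2))\<^sup>2"
    unfolding rank_factor_pair by (simp add: algebra_simps power2_eq_square mult_2_right power_add)
  finally show ?case by simp
next
  case (ge2 t)
  have len: "Suc (2 * h) + sum_list (replicate (Suc (Suc t)) 1) = Suc (2 * Suc h) + t"
    "Suc (2 * Suc h) + sum_list (replicate t 1) = Suc (2 * Suc h) + t"
    by (simp_all add: sum_list_replicate)
  have "gen0 x (Suc (2 * h)) (replicate (Suc (Suc t)) 1) =
      (1 - x ^ (2 * h + 2))\<^sup>2 * gen0 x (Suc (2 * Suc h)) (replicate t 1)"
    unfolding gen0_def len alt_odd_append[symmetric] unfolding replicate_Suc by (rule gen_odd_singletons)
  also have "\<dots> = ((1 - x ^ (2 * h + 2)) * (\<Prod>i = 2 * Suc h + 2..2 * Suc h + 1 + t. rank_factor x i))\<^sup>2"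
    unfolding ge2.IH(1) power_mult_distrib ..
  also have "\<dots> = (\<Prod>i = 2 * h + 2..2 * Suc h + 1 + t. rank_factor x i)\<^sup>2"
    by (subst (2) prod_rank_factor_pair) simp_all
  finally show ?case by simp
qed

text \<open>Each absorbed pair yields \<open>(1 - x^(2*h+2))^2 / (1 - x^2)\<close>. One copy of the
  numerator, with the denominator, raises \<open>qfact h\<close> to \<open>qfact (Suc h)\<close>;
  the other is the next two factors of the first product. The singletons left at the end supply both
  remaining products.\<close>

lemma gen0_odd:
  assumes "n = 2 * h + 1 + 2 * m + t"
  shows "qfact h (x\<^sup>2) * gen0 x (Suc (2 * h)) (replicate m 2 @ replicate t 1) =
    qfact (h + m) (x\<^sup>2) * (\<Prod>i = 2 * h + 2..n. rank_factor x i) *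
      (\<Prod>j = 2 * (h + m) + 2..n. rank_factor x j)"
  using assms
proof (induction m arbitrary: h)
  case 0
  then show ?case
    using gen0_odd_singletons[of h t] by (simp add: power2_eq_square)
next
  case (Suc m)
  let ?r = "replicate m 2 @ replicate t 1"
  have n: "n = 2 * Suc h + 1 + 2 * m + t" using Suc.prems by simp
  have s: "sum_list ?r = 2 * m + t" by (simp add: sum_list_replicate)
  have len: "Suc (2 * h) + sum_list (2 # ?r) = Suc (2 * Suc h) + (2 * m + t)"
    "Suc (2 * Suc h) + sum_list ?r = Suc (2 * Suc h) + (2 * m + t)"
    by (simp_all only: sum_list.Cons s) simp
  have 1: "(1 - x\<^sup>2) * gen0 x (Suc (2 * h)) (2 # ?r) =
      (1 - x ^ (2 * h + 2))\<^sup>2 * gen0 x (Suc (2 * Suc h)) ?r"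
    unfolding gen0_def len alt_odd_append[symmetric] by (rule gen_odd_pair)
  have q1: "(1 - x ^ (2 * h + 2)) * qfact h (x\<^sup>2) = (1 - x\<^sup>2) * qfact (Suc h) (x\<^sup>2)"
    using qfact_Suc[of h] by simp
  have "(1 - x\<^sup>2) * (qfact h (x\<^sup>2) * gen0 x (Suc (2 * h)) (2 # ?r)) =
      ((1 - x ^ (2 * h + 2)) * qfact h (x\<^sup>2)) * (1 - x ^ (2 * h + 2)) * gen0 x (Suc (2 * Suc h)) ?r"
    using 1 by (simp only: mult.left_commute[of _ "qfact h (x\<^sup>2)"] power2_eq_square mult_ac)
  also have "\<dots> = (1 - x\<^sup>2) * (1 - x ^ (2 * h + 2)) * (qfact (Suc h) (x\<^sup>2) * gen0 x (Suc (2 * Suc h)) ?r)"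
    unfolding q1 by (simp only: mult_ac)
  also have "qfact (Suc h) (x\<^sup>2) * gen0 x (Suc (2 * Suc h)) ?r =
      qfact (h + Suc m) (x\<^sup>2) * (\<Prod>i = 2 * Suc h + 2..n. rank_factor x i) *
        (\<Prod>j = 2 * (h + Suc m) + 2..n. rank_factor x j)"
    using Suc.IH[OF n] by (simp only: add_Suc add_Suc_right)
  finally have "(1 - x\<^sup>2) * (qfact h (x\<^sup>2) * gen0 x (Suc (2 * h)) (2 # ?r)) =
    (1 - x\<^sup>2) * (qfact (h + Suc m) (x\<^sup>2) * (\<Prod>i = 2 * h + 2..n. rank_factor x i) *
      (\<Prod>j = 2 * (h + Suc m) + 2..n. rank_factor x j))"
    using n by (subst prod_rank_factor_pair) (simp_all add: mult_ac)
  then show ?case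
    using square_neq_1 by simp
qed

text \<open>A singleton, if there is one, can be brought next to the even block in the right phase.
  Absorbing it makes the block odd and explains the factor \<open>1 + x^|I_0|\<close>.\<close>

lemma gen0_even_singleton:
  assumes "n = 2 * h + 2 * m + Suc t"
  shows "qfact h (x\<^sup>2) * gen0 x (2 * h) (replicate m 2 @ replicate (Suc t) 1) =
    (1 + x ^ (2 * h)) * (qfact (h + m) (x\<^sup>2) * (\<Prod>i = 2 * h + 2..n. rank_factor x i) *
      (\<Prod>j = 2 * (h + m) + 2..n. rank_factor x j))"
proof -
  let ?r = "replicate m 2 @ replicate t 1"
  have len: "2 * h + sum_list (1 # ?r) = Suc (2 * h) + sum_list ?r" by simp
  have "gen0 x (2 * h) (1 # ?r) = (1 + x ^ (2 * h)) * gen0 x (Suc (2 * h)) ?r"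
    unfolding gen0_def len alt_odd_append[symmetric]
    by (simp only: gen_prefix_same flip: alt_snoc_append(1))
  moreover have "gen0 x (2 * h) (replicate m 2 @ replicate (Suc t) 1) = gen0 x (2 * h) (1 # ?r)"
    using gen0_bubble[of "2 * h" m t] by simp
  ultimately show ?thesis
    using gen0_odd[of n h m t] assms by (simp add: mult_ac)
qed

text \<open>Without singletons the first pair must be split. Both colour orders lead to multiples of
  the same \<open>?O\<close>, and their coefficients add up to the numerator of the exceptional
  \<open>f_factor\<close>. Its denominator arises because \<open>?O\<close> supplies only the half
  \<open>1 - x^M\<close> of \<open>1 - x^(2*M)\<close>.\<close>

lemma gen0_even_pairs:
  assumes "n = 2 * M" "M = h + m" "0 < m"
  shows "(1 + x ^ M) * (qfact h (x\<^sup>2) * gen0 x (2 * h) (replicate m 2)) =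
    (1 + x ^ (2 * h) + 2 * x ^ M) * (qfact M (x\<^sup>2) * (\<Prod>i = 2 * h + 2..n. rank_factor x i))"
proof -
  obtain r where r: "m = Suc r" using assms(3) by (cases m) auto
  let ?r = "replicate r (2 :: nat)"
  let ?O = "gen0 x (Suc (2 * h)) (1 # ?r)"
  have l: "length (alt True (2 * h)) = 2 * h + sum_list []"
    and l': "length (alt False (Suc (2 * h))) = Suc (2 * h) + sum_list []" by simp_all
  have s: "sum_list ?r = 2 * r" by (simp add: sum_list_replicate)
  have "alt True (2 * h + (2 + 2 * r)) = alt True (2 * h) @ alt True 2 @ alt True (2 * r)"
    by (simp only: alt_even_append[symmetric] alt_add[of True 2 "2 * r"] even_numeral if_True)
  moreover have "alt c (Suc (2 * h) + (1 + 2 * r)) = alt c (Suc (2 * h)) @ alt (\<not> c) (1 + 2 * r)" for c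
    by (simp only: alt_odd_append)
  ultimately have a: "alt True (2 * h + sum_list (2 # ?r)) = alt True (2 * h) @ alt True 2 @ alt True (2 * r)"
    "alt c (Suc (2 * h) + sum_list (1 # ?r)) = alt c (Suc (2 * h)) @ (\<not> c) # alt c (2 * r)"
    "alt c (Suc (2 * h) + sum_list (1 # ?r)) = alt c (Suc (2 * h)) @ alt (\<not> c) (2 * r + 1)" for c
    by (simp_all only: sum_list.Cons s) simp_all
  have flip: "gen x (Suc (2 * h)) (1 # ?r) (alt False (Suc (2 * h) + sum_list (1 # ?r))) = ?O"
    using gen_map_Not[of x "Suc (2 * h)" "1 # ?r" "alt True (Suc (2 * h) + sum_list (1 # ?r))"]
    unfolding gen0_def map_Not_alt by simp
  have 1: "gen x (2 * h) (1 # 1 # ?r) (alt True (2 * h) @ True # False # alt True (2 * r)) =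
      (1 + x ^ (2 * h)) * ?O"
    using gen_prefix_same[of x h "1 # ?r" True "False # alt True (2 * r)"]
    unfolding gen0_def a(2) by simp
  have "gen x (2 * h) (1 # 1 # ?r) (alt True (2 * h) @ False # True # alt True (2 * r)) =
      2 * x ^ h * gen x (Suc (2 * h)) (1 # ?r) (alt False (Suc (2 * h)) @ True # alt True (2 * r))"
    using gen_prefix_other[of x h "1 # ?r" False "True # alt True (2 * r)"] by simp
  \<comment> \<open>The second letter of the split pair is now out of phase with the
    \<open>r\<close> pairs behind it, and passing them costs \<open>x^r\<close>; the global colour
    change \<open>flip\<close> identifies the result with \<open>?O\<close>.\<close>
  also have "gen x (Suc (2 * h)) (1 # ?r) (alt False (Suc (2 * h)) @ True # alt True (2 * r)) = x ^ r * ?O"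
    using gen_move_singleton[OF l', of r "[]" True "[]"] flip a(3)[of False]
    by (simp del: alt.simps)
  finally have 2: "gen x (2 * h) (1 # 1 # ?r) (alt True (2 * h) @ False # True # alt True (2 * r)) =
      2 * x ^ h * (x ^ r * ?O)" .
  \<comment> \<open>The exponent is \<open>M = h + r + 1\<close>: \<open>x\<close> from
    \<open>gen_pair_solve\<close>, \<open>x^h\<close> from the block in the wrong phase,
    \<open>x^r\<close> from the pairs.\<close>
  have 3: "(1 - x\<^sup>2) * gen0 x (2 * h) (2 # ?r) = (1 + x ^ (2 * h) + 2 * x ^ M) * ?O"
    using gen_pair_solve[OF l, of ?r True "alt True (2 * r)"] 1 2
    unfolding gen0_def[of _ "2 * h"] a(1) by (simp add: assms(2) r power_add algebra_simps del: alt.simps)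
  have "2 * h + 1 + 2 * r + 1 = n" "2 * (h + r) + 2 = n" using assms r by simp_all
  \<comment> \<open>With one singleton the second product of \<open>gen0_odd\<close> has the single
    index \<open>n = 2 * M\<close>.\<close>
  then have 4: "qfact h (x\<^sup>2) * ?O =
      qfact (h + r) (x\<^sup>2) * (\<Prod>i = 2 * h + 2..n. rank_factor x i) * (1 - x ^ M)"
    using gen0_odd[of n h r 1] gen0_bubble[of "Suc (2 * h)" r 0] rank_factor_pair(1)[of x "h + r"]
    by (simp add: assms(2) r)
  have q: "(1 + x ^ M) * (1 - x ^ M) * qfact (h + r) (x\<^sup>2) = (1 - x\<^sup>2) * qfact M (x\<^sup>2)"
    using qfact_Suc[of "h + r"] assms(2) r
    by (simp add: algebra_simps mult_2_right power_add)
  have "(1 - x\<^sup>2) * ((1 + x ^ M) * (qfact h (x\<^sup>2) * gen0 x (2 * h) (2 # ?r))) =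
      (1 + x ^ M) * (1 + x ^ (2 * h) + 2 * x ^ M) * (qfact h (x\<^sup>2) * ?O)"
    using 3 by (metis (no_types, lifting) mult.assoc mult.left_commute)
  also have "\<dots> = ((1 + x ^ M) * (1 - x ^ M) * qfact (h + r) (x\<^sup>2)) * (1 + x ^ (2 * h) + 2 * x ^ M) *
     (\<Prod>i = 2 * h + 2..n. rank_factor x i)"
    unfolding 4 by (simp only: mult_ac)
  finally have "(1 - x\<^sup>2) * ((1 + x ^ M) * (qfact h (x\<^sup>2) * gen0 x (2 * h) (2 # ?r))) =
     (1 - x\<^sup>2) * ((1 + x ^ (2 * h) + 2 * x ^ M) * (qfact M (x\<^sup>2) * (\<Prod>i = 2 * h + 2..n. rank_factor x i)))"
    unfolding q by (simp only: mult_ac)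
  then show ?thesis
    using square_neq_1 r by simp
qed

end

section \<open>From signed permutations to words\<close>

definition word :: "nat \<Rightarrow> (int \<Rightarrow> int) \<Rightarrow> int list" where
  "word n \<sigma> = map \<sigma> [1..int n]"

lemma length_word [simp]: "length (word n \<sigma>) = n"
  by (simp add: word_def)

lemma nth_word: "i < n \<Longrightarrow> word n \<sigma> ! i = \<sigma> (int i + 1)"
  by (simp add: word_def add.commute)

lemma signed_permsD:
  assumes "\<sigma> \<in> signed_perms n" "i \<in> {1..int n}"
  shows "\<bar>\<sigma> i\<bar> \<in> {1..int n}" "\<sigma> (- i) = - \<sigma> i"
proof -
  have p: "\<sigma> permutes ({- int n..-1} \<union> {1..int n})" using assms by (simp add: signed_perms_def)
  have "\<sigma> i \<in> {- int n..-1} \<union> {1..int n}"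
    using permutes_in_image[OF p, of i] assms(2) by blast
  then show "\<bar>\<sigma> i\<bar> \<in> {1..int n}" by auto
  show "\<sigma> (- i) = - \<sigma> i" using assms by (simp add: signed_perms_def)
qed

lemma word_in_signed_words:
  assumes "\<sigma> \<in> signed_perms n"
  shows "word n \<sigma> \<in> signed_words n"
proof -
  have p: "\<sigma> permutes ({- int n..-1} \<union> {1..int n})" using assms by (simp add: signed_perms_def)
  have inj: "inj_on (\<lambda>i. \<bar>\<sigma> i\<bar>) {1..int n}"
  proof (rule inj_onI)
    fix i j assume ij: "i \<in> {1..int n}" "j \<in> {1..int n}" "\<bar>\<sigma> i\<bar> = \<bar>\<sigma> j\<bar>"
    then have "\<sigma> i = \<sigma> j \<or> \<sigma> i = \<sigma> (- j)"
      using signed_permsD(2)[OF assms ij(2)] by (auto simp: abs_eq_iff)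
    then have "i = j \<or> i = - j" using permutes_inj[OF p] by (auto dest: injD)
    with ij show "i = j" by auto
  qed
  moreover have "(\<lambda>i. \<bar>\<sigma> i\<bar>) ` {1..int n} = {1..int n}"
    by (rule endo_inj_surj) (use signed_permsD(1)[OF assms] inj in auto)
  moreover have "map abs (word n \<sigma>) = map (\<lambda>i. \<bar>\<sigma> i\<bar>) [1..int n]" by (simp add: word_def)
  ultimately have "distinct (map abs (word n \<sigma>))" "set (map abs (word n \<sigma>)) = {1..int n}"
    by (simp_all only: distinct_map set_map set_upto distinct_upto simp_thms)
  then show ?thesis
    by (simp only: signed_words_def mem_Collect_eq simp_thms)
qed

lemma signed_word_nth:
  assumes "xs \<in> signed_words n" "i < n"
  shows "\<bar>xs ! i\<bar> \<in> {1..int n}" "\<And>j. j < n \<Longrightarrow> \<bar>xs ! i\<bar> = \<bar>xs ! j\<bar> \<Longrightarrow> i = j"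
proof -
  have l: "length xs = n" by (rule length_signed_word) fact
  have "abs (xs ! i) \<in> set (map abs xs)" using l assms(2) by simp
  then show "\<bar>xs ! i\<bar> \<in> {1..int n}" using assms(1) by (simp add: signed_words_def del: set_map)
  show "i = j" if "j < n" "\<bar>xs ! i\<bar> = \<bar>xs ! j\<bar>" for j
    using assms l that nth_eq_iff_index_eq[of "map abs xs" i j] by (simp add: signed_words_def)
qed

lemma bij_betw_word: "bij_betw (word n) (signed_perms n) (signed_words n)"
proof (rule bij_betwI')
  fix \<sigma> \<tau> assume st: "\<sigma> \<in> signed_perms n" "\<tau> \<in> signed_perms n"
  show "word n \<sigma> = word n \<tau> \<longleftrightarrow> \<sigma> = \<tau>"
  proof
    assume "word n \<sigma> = word n \<tau>"
    then have pos: "\<sigma> i = \<tau> i" if "i \<in> {1..int n}" for i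
      using that by (auto simp: word_def)
    show "\<sigma> = \<tau>"
    proof
      fix i
      consider "i \<in> {1..int n}" | "- i \<in> {1..int n}" | "i \<notin> {- int n..-1} \<union> {1..int n}" by force
      then show "\<sigma> i = \<tau> i"
      proof cases
        case 2
        then show ?thesis
          using pos[OF 2] signed_permsD(2)[OF st(1) 2] signed_permsD(2)[OF st(2) 2] by simp
      next
        case 3
        then show ?thesis using st by (simp add: signed_perms_def permutes_def)
      qed (rule pos)
    qed
  qed simp
next
  fix \<sigma> assume "\<sigma> \<in> signed_perms n"
  then show "word n \<sigma> \<in> signed_words n" by (rule word_in_signed_words)
next
  fix xs assume xs: "xs \<in> signed_words n"
  then have l: "length xs = n" by (rule length_signed_word)
  define S where "S = {- int n..-1} \<union> {1..int n}"
  define \<sigma> where "\<sigma> i = (if i \<in> {1..int n} then xs ! nat (i - 1)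
     else if - i \<in> {1..int n} then - xs ! nat (- i - 1) else i)" for i
  have neg: "\<sigma> (- i) = - \<sigma> i" for i by (auto simp: \<sigma>_def)
  have pos: "\<bar>\<sigma> i\<bar> = \<bar>xs ! nat (\<bar>i\<bar> - 1)\<bar>" "nat (\<bar>i\<bar> - 1) < n" if "i \<in> S" for i
    using that by (auto simp: \<sigma>_def S_def)
  have "\<sigma> i \<in> S" if "i \<in> S" for i
    using signed_word_nth(1)[OF xs pos(2)[OF that]] pos(1)[OF that] by (auto simp: S_def)
  moreover have "inj_on \<sigma> S"
  proof (rule inj_onI)
    fix i j assume ij: "i \<in> S" "j \<in> S" "\<sigma> i = \<sigma> j"
    have "nat (\<bar>i\<bar> - 1) = nat (\<bar>j\<bar> - 1)"
      by (rule signed_word_nth(2)[OF xs]) (use ij pos[OF ij(1)] pos[OF ij(2)] in auto)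
    then have "i = j \<or> i = - j" using ij by (auto simp: S_def)
    moreover have "\<sigma> j \<noteq> 0"
      using signed_word_nth(1)[OF xs pos(2)[OF ij(2)]] pos(1)[OF ij(2)] by auto
    ultimately show "i = j" using neg[of j] ij(3) by auto
  qed
  moreover have "finite S" by (simp add: S_def)
  ultimately have "bij_betw \<sigma> S S"
    by (metis bij_betw_def endo_inj_surj image_subsetI)
  moreover have "\<sigma> i = i" if "i \<notin> S" for i
    using that by (auto simp: \<sigma>_def S_def)
  ultimately have "\<sigma> permutes S"
    by (intro bij_imp_permutes)
  then have "\<sigma> \<in> signed_perms n"
    using neg by (simp add: signed_perms_def S_def)
  moreover have "word n \<sigma> = xs"
    by (rule nth_equalityI) (auto simp: nth_word l \<sigma>_def)
  ultimately show "\<exists>\<sigma>\<in>signed_perms n. xs = word n \<sigma>" by blast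
qed

text \<open>Passes from positions \<open>1..n\<close> to list indices starting at 0.\<close>

lemma card_pairs:
  "card {(i, j) \<in> {1..int n} \<times> {1..int n}. i < j \<and> Q i j} =
    (\<Sum>i<n. \<Sum>j=Suc i..<n. if Q (int i + 1) (int j + 1) then 1 else 0)"
proof -
  let ?S = "SIGMA i:{..<n}. {j \<in> {Suc i..<n}. Q (int i + 1) (int j + 1)}"
  let ?f = "\<lambda>(i, j). (int i + 1, int j + 1)"
  have "{(i, j) \<in> {1..int n} \<times> {1..int n}. i < j \<and> Q i j} = ?f ` ?S" (is "?L = _")
  proof
    show "?L \<subseteq> ?f ` ?S"
    proof
      fix p assume "p \<in> ?L"
      then obtain i j where p: "p = (i, j)" "1 \<le> i" "i < j" "j \<le> int n" "Q i j" by auto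
      then have "(nat (i - 1), nat (j - 1)) \<in> ?S" "p = ?f (nat (i - 1), nat (j - 1))" by auto
      then show "p \<in> ?f ` ?S" by blast
    qed
  qed auto
  moreover have "inj_on ?f ?S" by (auto simp: inj_on_def)
  ultimately have "card ?L = card ?S" by (simp add: card_image)
  also have "\<dots> = (\<Sum>i<n. card {j \<in> {Suc i..<n}. Q (int i + 1) (int j + 1)})"
    by (rule card_SigmaI) auto
  also have "\<dots> = (\<Sum>i<n. \<Sum>j=Suc i..<n. if Q (int i + 1) (int j + 1) then 1 else 0)"
    by (simp add: sum.inter_filter[symmetric])
  finally show ?thesis .
qed

lemma weight_nth:
  "weight x zs = (\<Prod>i<length zs. \<Prod>j=Suc i..<length zs. pair_weight x (zs ! i) (zs ! j))"
proof (induction zs)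
  case (Cons z zs)
  have "(\<Prod>j=Suc 0..<Suc (length zs). pair_weight x z ((z # zs) ! j)) =
      prod_list (map (pair_weight x z) zs)"
    by (simp only: prod.shift_bounds_Suc_ivl)
      (simp add: prod.list_conv_set_nth atLeast0LessThan)
  then show ?case
    using Cons by (simp only: list.size(4) add_0_right add_Suc_right prod.lessThan_Suc_shift
        prod.shift_bounds_Suc_ivl) simp
qed simp

text \<open>List index \<open>i\<close> is position \<open>i + 1\<close>, so equal colours mean
  positions of equal parity. Every event thus gives \<open>- 1\<close>, and an extra
  \<open>x\<close> exactly if it counts for the odd length.\<close>

lemma weight_word:
  "weight x (zip (alt True n) (word n \<sigma>)) = (- 1) ^ coxeter_length n \<sigma> * x ^ odd_length n \<sigma>"
proof -
  define a where "a i j = (if \<sigma> (int j + 1) < \<sigma> (int i + 1) then 1 else 0 :: nat) +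
    (if \<sigma> (int i + 1) + \<sigma> (int j + 1) < 0 then 1 else 0)" for i j
  define b where "b i j = (if \<sigma> (int j + 1) < \<sigma> (int i + 1) \<and> (int i + 1) mod 2 \<noteq> (int j + 1) mod 2 then 1 else 0 :: nat) +
    (if \<sigma> (int i + 1) + \<sigma> (int j + 1) < 0 \<and> (int i + 1) mod 2 \<noteq> (int j + 1) mod 2 then 1 else 0)" for i j
  have "coxeter_length n \<sigma> = (\<Sum>i<n. \<Sum>j=Suc i..<n. a i j)"
    unfolding coxeter_length_def card_pairs a_def by (simp only: sum.distrib)
  moreover have "odd_length n \<sigma> = (\<Sum>i<n. \<Sum>j=Suc i..<n. b i j)"
    unfolding odd_length_def card_pairs b_def by (simp only: sum.distrib)
  moreover have "pair_weight x (zip (alt True n) (word n \<sigma>) ! i) (zip (alt True n) (word n \<sigma>) ! j) =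
      (- 1) ^ a i j * x ^ b i j" if "i < n" "j < n" for i j
  proof -
    have par: "(int i + 1) mod 2 = (int j + 1) mod 2 \<longleftrightarrow> (even i \<longleftrightarrow> even j)"
      by presburger
    have "pair_weight x (zip (alt True n) (word n \<sigma>) ! i) (zip (alt True n) (word n \<sigma>) ! j) =
       twist x (even i) (even j) ^ a i j"
      using that by (simp add: pair_weight_def nth_alt nth_word desc_count_def a_def)
    also have "\<dots> = (- 1) ^ a i j * x ^ b i j"
      by (cases "even i \<longleftrightarrow> even j") (auto simp: twist_def a_def b_def par)
    finally show ?thesis .
  qed
  ultimately show ?thesis
    by (simp add: weight_nth prod.distrib power_sum)
qed

section \<open>Removing the parity condition on signs\<close>

text \<open>The ascent at position \<open>i\<close> compares the list entries \<open>i - 1\<close>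
  and \<open>i\<close>; the case \<open>i = 0\<close> is the convention
  \<open>\<sigma>(0) = - \<sigma>(2)\<close>.\<close>

definition ascents_at :: "nat set \<Rightarrow> int list \<Rightarrow> bool" where
  "ascents_at I xs \<longleftrightarrow> (\<forall>i\<in>I. if i = 0 then - xs ! 1 < xs ! 0 else xs ! (i - 1) < xs ! i)"

definition ascent_words :: "nat \<Rightarrow> nat set \<Rightarrow> int list set" where
  "ascent_words n I = {xs \<in> signed_words n. ascents_at I xs}"

lemma finite_ascent_words: "finite (ascent_words n I)"
  by (simp add: ascent_words_def finite_signed_words)

definition even_signed :: "int list \<Rightarrow> bool" where
  "even_signed xs \<longleftrightarrow> even (length (filter (\<lambda>y. y < 0) xs))"

lemma even_signed_word: "even (card {i \<in> {1..int n}. \<sigma> i < 0}) \<longleftrightarrow> even_signed (word n \<sigma>)"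
proof -
  have "length (filter (\<lambda>y. y < 0) (word n \<sigma>)) = length (filter (\<lambda>i. \<sigma> i < 0) [1..int n])"
    by (simp add: word_def filter_map comp_def)
  also have "\<dots> = card (set (filter (\<lambda>i. \<sigma> i < 0) [1..int n]))"
    by (rule distinct_card[symmetric]) simp
  finally show ?thesis by (simp add: even_signed_def)
qed

lemma ascents_at_word:
  assumes "n \<ge> 2" "I \<subseteq> {0..n - 1}"
  shows "(\<forall>i\<in>I. ext0 \<sigma> i < ext0 \<sigma> (i + 1)) \<longleftrightarrow> ascents_at I (word n \<sigma>)"
  unfolding ascents_at_def
proof (rule ball_cong[OF refl])
  fix i assume "i \<in> I"
  then have "i < n" using assms by auto
  then show "ext0 \<sigma> i < ext0 \<sigma> (i + 1) \<longleftrightarrow>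
      (if i = 0 then - word n \<sigma> ! 1 < word n \<sigma> ! 0 else word n \<sigma> ! (i - 1) < word n \<sigma> ! i)"
    using assms(1) by (auto simp: ext0_def nth_word of_nat_diff add.commute)
qed

lemma D_gen_eq_words:
  assumes "n \<ge> 2" "I \<subseteq> {0..n - 1}"
  shows "D_gen n I x = (\<Sum>xs | xs \<in> ascent_words n I \<and> even_signed xs. weight x (zip (alt True n) xs))"
proof -
  have "bij_betw (word n) (D_quotient n I) {xs. xs \<in> ascent_words n I \<and> even_signed xs}"
  proof (rule bij_betw_subset[OF bij_betw_word[of n], THEN bij_betw_cong[THEN iffD1, rotated]])
    show "D_quotient n I \<subseteq> signed_perms n" by (auto simp: D_quotient_def weyl_D_def)
    show "word n ` D_quotient n I = {xs. xs \<in> ascent_words n I \<and> even_signed xs}"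
    proof -
      have "D_quotient n I = {\<sigma> \<in> signed_perms n. ascents_at I (word n \<sigma>) \<and> even_signed (word n \<sigma>)}"
        unfolding D_quotient_def weyl_D_def even_signed_word ascents_at_word[OF assms] by blast
      then show ?thesis
        using bij_betw_imp_surj_on[OF bij_betw_word[of n]] by (auto simp: ascent_words_def)
    qed
  qed simp
  then have "(\<Sum>\<sigma>\<in>D_quotient n I. weight x (zip (alt True n) (word n \<sigma>))) =
      (\<Sum>xs | xs \<in> ascent_words n I \<and> even_signed xs. weight x (zip (alt True n) xs))"
    by (rule sum.reindex_bij_betw)
  then show ?thesis by (simp add: D_gen_def weight_word)
qed

definition flip_one :: "int \<Rightarrow> int" where
  "flip_one y = (if \<bar>y\<bar> = 1 then - y else y)"

lemma flip_one_simps [simp]: "\<bar>flip_one y\<bar> = \<bar>y\<bar>" "flip_one (flip_one y) = y"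
  by (auto simp: flip_one_def)

text \<open>No nonzero integer lies strictly between \<open>- 1\<close> and \<open>1\<close>, so
  exchanging these two cannot affect a comparison with a letter of another absolute value.\<close>

lemma flip_one_compare:
  assumes "\<bar>a\<bar> \<noteq> \<bar>b\<bar>" "a \<noteq> 0" "b \<noteq> 0"
  shows "flip_one a < flip_one b \<longleftrightarrow> a < b" "- flip_one a < flip_one b \<longleftrightarrow> - a < b"
    "desc_count (flip_one a) (flip_one b) = desc_count a b"
  using assms by (auto simp: flip_one_def desc_count_def)

lemma signed_words_flip: "map flip_one xs \<in> signed_words n \<longleftrightarrow> xs \<in> signed_words n"
  by (rule signed_words_mset_cong) (simp add: comp_def)

lemma signed_word_distinct:
  assumes "xs \<in> signed_words n" "i < n" "j < n" "i \<noteq> j"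
  shows "\<bar>xs ! i\<bar> \<noteq> \<bar>xs ! j\<bar>" "xs ! i \<noteq> 0" "xs ! j \<noteq> 0"
  using signed_word_nth[OF assms(1,2)] signed_word_nth(1)[OF assms(1,3)] assms(3,4) by auto

lemma ascents_at_flip:
  assumes "xs \<in> signed_words n" "n \<ge> 2" "I \<subseteq> {0..n - 1}"
  shows "ascents_at I (map flip_one xs) \<longleftrightarrow> ascents_at I xs"
  unfolding ascents_at_def
proof (rule ball_cong[OF refl])
  fix i assume "i \<in> I"
  then have i: "i < n" using assms by auto
  note l = length_signed_word[OF assms(1)]
  show "(if i = 0 then - map flip_one xs ! 1 < map flip_one xs ! 0
       else map flip_one xs ! (i - 1) < map flip_one xs ! i) \<longleftrightarrow>
     (if i = 0 then - xs ! 1 < xs ! 0 else xs ! (i - 1) < xs ! i)"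
  proof (cases "i = 0")
    case True
    then show ?thesis
      using flip_one_compare(2)[OF signed_word_distinct[OF assms(1), of 1 0]] assms(2) l by simp
  next
    case False
    then show ?thesis
      using flip_one_compare(1)[OF signed_word_distinct[OF assms(1), of "i - 1" i]] i l by simp
  qed
qed

lemma weight_flip:
  assumes "xs \<in> signed_words n"
  shows "weight x (zip (alt c n) (map flip_one xs)) = weight x (zip (alt c n) xs)"
proof -
  note l = length_signed_word[OF assms]
  have "pair_weight x (zip (alt c n) (map flip_one xs) ! i) (zip (alt c n) (map flip_one xs) ! j) =
     pair_weight x (zip (alt c n) xs ! i) (zip (alt c n) xs ! j)" if "i < n" "j \<in> {Suc i..<n}" for i j
    using that l flip_one_compare(3)[OF signed_word_distinct[OF assms, of i j]]
    by (simp add: pair_weight_def)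
  then show ?thesis
    using l by (simp add: weight_nth)
qed

lemma even_signed_flip:
  assumes "xs \<in> signed_words n" "n \<ge> 1"
  shows "even_signed (map flip_one xs) \<longleftrightarrow> \<not> even_signed xs"
proof -
  have d: "distinct (map abs xs)" "set (map abs xs) = {1..int n}"
    using assms(1) by (simp_all add: signed_words_def del: set_map)
  moreover have "(1 :: int) \<in> {1..int n}" using assms(2) by simp
  ultimately obtain y where y: "y \<in> set xs" "\<bar>y\<bar> = 1" by force
  then obtain P R where xs: "xs = P @ y # R" by (meson split_list)
  have "map flip_one P = P" "map flip_one R = R"
    using d(1) y(2) by (auto simp: xs flip_one_def intro!: map_idI)
  then show ?thesis using y(2) by (auto simp: xs flip_one_def even_signed_def)
qed

text \<open>
  Changing the sign of the entry \<open>\<plusminus>1\<close> preserves all comparisons and reverses the parity of the number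
  of negative entries, so type D gives exactly half of type B.
\<close>

lemma two_D_gen:
  assumes "n \<ge> 2" "I \<subseteq> {0..n - 1}"
  shows "2 * D_gen n I x = (\<Sum>xs\<in>ascent_words n I. weight x (zip (alt True n) xs))"
proof -
  let ?w = "\<lambda>xs. weight x (zip (alt True n) xs)"
  have "(\<Sum>xs\<in>ascent_words n I. ?w xs) =
      sum ?w {xs. xs \<in> ascent_words n I \<and> even_signed xs} + sum ?w {xs. xs \<in> ascent_words n I \<and> \<not> even_signed xs}"
    using finite_ascent_words
    by (subst sum.union_disjoint[symmetric]) (auto intro!: sum.cong)
  also have "sum ?w {xs. xs \<in> ascent_words n I \<and> \<not> even_signed xs} =
      sum ?w {xs. xs \<in> ascent_words n I \<and> even_signed xs}"
    by (rule sum.reindex_bij_witness[where i = "map flip_one" and j = "map flip_one"])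
      (use assms in \<open>auto simp: ascent_words_def ascents_at_flip signed_words_flip even_signed_flip
          weight_flip comp_def\<close>)
  finally show ?thesis
    by (simp add: D_gen_eq_words[OF assms])
qed

fun neg_hd :: "int list \<Rightarrow> int list" where
  "neg_hd [] = []"
| "neg_hd (y # ys) = - y # ys"

lemma neg_hd_neg_hd [simp]: "neg_hd (neg_hd xs) = xs"
  by (cases xs) auto

lemma signed_words_neg_hd [simp]: "neg_hd xs \<in> signed_words n \<longleftrightarrow> xs \<in> signed_words n"
  by (rule signed_words_mset_cong) (cases xs, auto)

lemma weight_neg_hd: "weight x (zip cs (neg_hd xs)) = weight x (zip cs xs)"
proof (cases xs)
  case (Cons y ys)
  have "pair_weight x (c, - y) = pair_weight x (c, y)" for c
    by (auto simp: pair_weight_def desc_count_def fun_eq_iff)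
  then show ?thesis using Cons by (cases cs) auto
qed simp

lemma neg_hd_nth: "xs \<noteq> [] \<Longrightarrow> neg_hd xs ! i = (if i = 0 then - xs ! 0 else xs ! i)"
  by (cases xs) (auto simp: nth_Cons')

text \<open>The sign change of the first letter realises the diagram automorphism exchanging 0 and 1.\<close>

lemma two_D_gen_swap:
  assumes "n \<ge> 2" "I \<subseteq> {0..n - 1}" "0 \<in> I" "1 \<notin> I"
  shows "2 * D_gen n I x = (\<Sum>xs\<in>ascent_words n (I - {0} \<union> {1}). weight x (zip (alt True n) xs))"
  unfolding two_D_gen[OF assms(1,2)]
proof (rule sum.reindex_bij_witness[where i = neg_hd and j = neg_hd])
  have I: "I = insert 0 (I - {0})" "I - {0} \<subseteq> {2..}" using assms(3,4) by (auto simp: numeral_2_eq_2 Suc_le_eq) (metis One_nat_def less_one linorder_neqE_nat)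
  have rest: "ascents_at (I - {0}) (neg_hd xs) \<longleftrightarrow> ascents_at (I - {0}) xs" if "xs \<noteq> []" for xs
    unfolding ascents_at_def
    by (rule ball_cong) (use I(2) that in \<open>auto simp: neg_hd_nth\<close>)
  have ins: "ascents_at (insert i J) xs \<longleftrightarrow> ascents_at {i} xs \<and> ascents_at J xs" for i J xs
    by (auto simp: ascents_at_def)
  have swap: "ascents_at I xs \<longleftrightarrow> ascents_at (I - {0} \<union> {1}) (neg_hd xs)"
    if "xs \<in> signed_words n" for xs
  proof -
    have "length xs \<ge> 2" using length_signed_word[OF that] assms(1) by simp
    then have ne: "xs \<noteq> []" by auto
    have "ascents_at {0} xs \<longleftrightarrow> ascents_at {1} (neg_hd xs)"
      using ne by (auto simp: ascents_at_def neg_hd_nth)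
    moreover have "ascents_at I xs \<longleftrightarrow> ascents_at {0} xs \<and> ascents_at (I - {0}) xs"
      by (subst I(1)) (rule ins)
    ultimately show ?thesis
      using rest[OF ne] ins[of 1 "I - {0}" "neg_hd xs"] by simp
  qed
  show "neg_hd xs \<in> ascent_words n (I - {0} \<union> {1})" if "xs \<in> ascent_words n I" for xs
    using that swap[of xs] by (simp add: ascent_words_def)
  show "neg_hd xs \<in> ascent_words n I" if "xs \<in> ascent_words n (I - {0} \<union> {1})" for xs
    using that swap[of "neg_hd xs"] by (simp add: ascent_words_def)
qed (simp_all add: weight_neg_hd)

section \<open>Ascent sets and compositions\<close>

text \<open>The ascents forced by consecutive blocks of sizes \<open>ns\<close> behind position
  \<open>s\<close>. Block ends are left out, so a block of size \<open>k\<close> corresponds to a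
  run of \<open>k - 1\<close> ascents and runs of different blocks never touch.\<close>

fun inner :: "nat \<Rightarrow> nat list \<Rightarrow> nat set" where
  "inner s [] = {}"
| "inner s (k # ns) = {Suc s..<s + k} \<union> inner (s + k) ns"

lemma inner_subset: "inner s ns \<subseteq> {s<..<s + sum_list ns}"
proof (induction ns arbitrary: s)
  case (Cons k ns)
  show ?case using Cons[of "s + k"] by auto
qed simp

lemma ex_inner:
  assumes "I \<subseteq> {s<..<s + N}"
  shows "\<exists>ns. sum_list ns = N \<and> I = inner s ns"
  using assms
proof (induction N arbitrary: s I rule: less_induct)
  case (less N)
  show ?case
  proof (cases "N = 0")
    case True
    then show ?thesis using less.prems by (intro exI[of _ "[]"]) auto
  next
    case False
    \<comment> \<open>The first gap of \<open>I\<close> behind \<open>s\<close> ends the first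
      block; a gap exists because \<open>s + N\<close> lies outside \<open>I\<close>.\<close>
    define k where "k = (LEAST k. 0 < k \<and> s + k \<notin> I)"
    have N: "0 < N \<and> s + N \<notin> I" using False less.prems by auto
    then have k: "0 < k" "s + k \<notin> I" "k \<le> N"
      unfolding k_def using LeastI[of "\<lambda>k. 0 < k \<and> s + k \<notin> I" N] Least_le[of "\<lambda>k. 0 < k \<and> s + k \<notin> I" N]
      by auto
    have low: "{Suc s..<s + k} \<subseteq> I"
    proof
      fix i assume i: "i \<in> {Suc s..<s + k}"
      then have "i - s < k" "0 < i - s" by auto
      then have "s + (i - s) \<in> I" unfolding k_def using not_less_Least by blast
      then show "i \<in> I" using i by simp
    qed
    have "I \<inter> {s + k<..} \<subseteq> {s + k<..<(s + k) + (N - k)}" using less.prems k by auto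
    then have "\<exists>ns. sum_list ns = N - k \<and> I \<inter> {s + k<..} = inner (s + k) ns"
      by (intro less.IH) (use k N in auto)
    then obtain ns where ns: "sum_list ns = N - k" "I \<inter> {s + k<..} = inner (s + k) ns" by blast
    have "I = {Suc s..<s + k} \<union> (I \<inter> {s + k<..})"
    proof
      show "I \<subseteq> {Suc s..<s + k} \<union> (I \<inter> {s + k<..})"
      proof
        fix i assume i: "i \<in> I"
        then have "i \<noteq> s + k" "s < i" using k less.prems by auto
        then show "i \<in> {Suc s..<s + k} \<union> (I \<inter> {s + k<..})" using i by auto
      qed
    qed (use low in auto)
    with ns k show ?thesis by (intro exI[of _ "k # ns"]) simp
  qed
qed

lemma ascents_at_Un: "ascents_at (I \<union> J) xs \<longleftrightarrow> ascents_at I xs \<and> ascents_at J xs"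
  by (auto simp: ascents_at_def)

lemma sorted_take_drop_iff:
  assumes "s + k \<le> length xs"
  shows "sorted_wrt (<) (take k (drop s xs)) \<longleftrightarrow> ascents_at {Suc s..<s + k} xs"
proof -
  have "sorted_wrt (<) (take k (drop s xs)) \<longleftrightarrow> (\<forall>i. Suc i < k \<longrightarrow> xs ! (s + i) < xs ! Suc (s + i))"
    using assms by (auto simp: sorted_wrt_iff_nth_Suc_transp)
  also have "\<dots> \<longleftrightarrow> ascents_at {Suc s..<s + k} xs"
  proof
    assume *: "\<forall>i. Suc i < k \<longrightarrow> xs ! (s + i) < xs ! Suc (s + i)"
    show "ascents_at {Suc s..<s + k} xs"
      unfolding ascents_at_def
    proof
      fix i assume "i \<in> {Suc s..<s + k}"
      then have "Suc (i - Suc s) < k" "s + (i - Suc s) = i - 1" "Suc (i - 1) = i" "i \<noteq> 0" by auto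
      then show "if i = 0 then - xs ! 1 < xs ! 0 else xs ! (i - 1) < xs ! i"
        using *[rule_format, of "i - Suc s"] by simp
    qed
  next
    assume *: "ascents_at {Suc s..<s + k} xs"
    show "\<forall>i. Suc i < k \<longrightarrow> xs ! (s + i) < xs ! Suc (s + i)"
    proof (intro allI impI)
      fix i assume "Suc i < k"
      then show "xs ! (s + i) < xs ! Suc (s + i)"
        using *[unfolded ascents_at_def, rule_format, of "Suc (s + i)"] by simp
    qed
  qed
  finally show ?thesis .
qed

lemma blockwise_increasing_iff_ascents:
  assumes "length xs = s + sum_list ns"
  shows "blockwise_increasing ns (drop s xs) \<longleftrightarrow> ascents_at (inner s ns) xs"
  using assms
proof (induction ns arbitrary: s)
  case Nil
  then show ?case by (simp add: ascents_at_def)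
next
  case (Cons k ns)
  have "blockwise_increasing (k # ns) (drop s xs) \<longleftrightarrow>
      sorted_wrt (<) (take k (drop s xs)) \<and> blockwise_increasing ns (drop k (drop s xs))"
    (is "?l \<longleftrightarrow> ?r")
  proof
    assume ?l
    then show ?r by (auto simp del: drop_drop)
  next
    assume r: ?r
    show ?l
      unfolding blockwise_increasing.simps
      by (rule exI[of _ "take k (drop s xs)"], rule exI[of _ "drop k (drop s xs)"])
        (use r Cons.prems in \<open>simp del: drop_drop\<close>)
  qed
  then show ?case
    using Cons.IH[of "s + k"] Cons.prems
    by (simp add: sorted_take_drop_iff ascents_at_Un add.commute)
qed

lemma in_blocks_iff:
  assumes "length xs = b + sum_list ns"
  shows "in_blocks b ns xs \<longleftrightarrow> sorted_wrt (<) (0 # take b xs) \<and> ascents_at (inner b ns) xs"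
proof -
  have "in_blocks b ns xs \<longleftrightarrow> sorted_wrt (<) (0 # take b xs) \<and> blockwise_increasing ns (drop b xs)"
    (is "?l \<longleftrightarrow> ?r")
  proof
    assume ?l
    then show ?r by (auto simp: in_blocks_def)
  next
    assume r: ?r
    show ?l
      unfolding in_blocks_def
      by (rule exI[of _ "take b xs"], rule exI[of _ "drop b xs"]) (use r assms in simp)
  qed
  then show ?thesis using blockwise_increasing_iff_ascents[OF assms] by simp
qed

lemma ascent_words_inner: "ascent_words (sum_list ns) (inner 0 ns) = block_words 0 ns"
  unfolding ascent_words_def block_words_def
  by (auto simp: in_blocks_iff length_signed_word)

text \<open>Ascents at 0 and 1 together say that the absolute value of the first letter is below the
  second letter. Negating the first letter thus preserves the set and the weight, and the words with
  positive first letter form one half.\<close>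

lemma sum_ascent_words_prefix:
  assumes "2 \<le> b" "n = b + sum_list ns"
  shows "(\<Sum>xs\<in>ascent_words n ({0..<b} \<union> inner b ns). weight x (zip (alt True n) xs)) =
    2 * gen x b ns (alt True n)"
proof -
  let ?T = "ascent_words n ({0..<b} \<union> inner b ns)"
  let ?w = "\<lambda>xs. weight x (zip (alt True n) xs)"
  have len: "length xs \<ge> 2" "xs \<noteq> []" "xs ! 0 \<noteq> 0" if "xs \<in> signed_words n" for xs
    using length_signed_word[OF that] signed_word_nth(1)[OF that, of 0] assms by auto
  have e: "{0..<b} = insert 0 {Suc 0..<0 + b}" using assms by auto
  have iff: "ascents_at ({0..<b} \<union> inner b ns) xs \<longleftrightarrow>
      - xs ! 1 < xs ! 0 \<and> sorted_wrt (<) (take b xs) \<and> ascents_at (inner b ns) xs"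
    if "xs \<in> signed_words n" for xs
    using sorted_take_drop_iff[of 0 b xs] length_signed_word[OF that] assms
    unfolding ascents_at_Un e by (auto simp: ascents_at_def)
  have tk: "\<exists>y z zs. take b xs = y # z # zs \<and> xs ! 0 = y \<and> xs ! 1 = z" if "xs \<in> signed_words n" for xs
  proof -
    have "length (take b xs) \<ge> 2" using length_signed_word[OF that] assms by simp
    then obtain y z zs where "take b xs = y # z # zs"
      by (metis Suc_le_length_iff numeral_2_eq_2)
    moreover from this have "xs = y # z # zs @ drop b xs" by (metis append_Cons append_take_drop_id)
    ultimately show ?thesis by (metis One_nat_def nth_Cons_0 nth_Cons_Suc)
  qed
  have pos: "{xs \<in> ?T. 0 < xs ! 0} = block_words b ns"
  proof (intro set_eqI)
    fix xs
    show "xs \<in> {xs \<in> ?T. 0 < xs ! 0} \<longleftrightarrow> xs \<in> block_words b ns"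
    proof (cases "xs \<in> signed_words n")
      case True
      then obtain y z zs where "take b xs = y # z # zs" "xs ! 0 = y" "xs ! 1 = z" using tk by blast
      then show ?thesis
        using True iff[OF True] in_blocks_iff[of xs b ns] length_signed_word[OF True] assms(2)
        by (auto simp: ascent_words_def block_words_def)
    qed (use assms(2) in \<open>auto simp: ascent_words_def block_words_def\<close>)
  qed
  have rest: "ascents_at (inner b ns) (neg_hd xs) \<longleftrightarrow> ascents_at (inner b ns) xs" if "xs \<in> signed_words n" for xs
    unfolding ascents_at_def
    by (rule ball_cong) (use inner_subset[of b ns] len[OF that] assms(1) in \<open>auto simp: neg_hd_nth\<close>)
  have neg: "neg_hd xs \<in> ?T \<longleftrightarrow> xs \<in> ?T" for xs
  proof (cases "xs \<in> signed_words n")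
    case True
    then obtain y z zs where tx: "take b xs = y # z # zs" "xs ! 0 = y" "xs ! 1 = z" using tk by blast
    have nx: "neg_hd xs \<in> signed_words n" using True by simp
    have "take b (neg_hd xs) = - y # z # zs"
      using tx(1) len(2)[OF True] by (cases xs; cases b) auto
    then show ?thesis
      using True nx iff[OF True] iff[OF nx] tx len[OF True] rest[OF True]
      by (auto simp: ascent_words_def neg_hd_nth)
  qed (auto simp: ascent_words_def)
  have "sum ?w ?T = sum ?w {xs \<in> ?T. 0 < xs ! 0} + sum ?w {xs \<in> ?T. \<not> 0 < xs ! 0}"
    using finite_ascent_words
    by (subst sum.union_disjoint[symmetric]) (auto intro!: sum.cong)
  also have "sum ?w {xs \<in> ?T. \<not> 0 < xs ! 0} = sum ?w {xs \<in> ?T. 0 < xs ! 0}"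
  proof (rule sum.reindex_bij_witness[where i = neg_hd and j = neg_hd])
    fix xs assume xs: "xs \<in> {xs \<in> ?T. \<not> 0 < xs ! 0}"
    then have "xs \<in> signed_words n" by (simp add: ascent_words_def)
    then show "neg_hd xs \<in> {xs \<in> ?T. 0 < xs ! 0}"
      using len[of xs] xs by (simp add: neg neg_hd_nth)
  next
    fix xs assume xs: "xs \<in> {xs \<in> ?T. 0 < xs ! 0}"
    then have "xs \<in> signed_words n" by (simp add: ascent_words_def)
    then show "neg_hd xs \<in> {xs \<in> ?T. \<not> 0 < xs ! 0}"
      using len[of xs] xs by (simp add: neg neg_hd_nth)
  qed (simp_all add: weight_neg_hd)
  finally show ?thesis by (simp add: pos gen_def)
qed
section \<open>Connected components\<close>

text \<open>The point \<open>p\<close> belongs to neither set, so no interval inside the union can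
  reach from one side to the other.\<close>

lemma components_Un:
  assumes A: "A \<subseteq> {..<p}" and B: "B \<subseteq> {p<..}"
  shows "components (A \<union> B) = components A \<union> components B"
proof -
  have side: "{a..b} \<subseteq> A \<or> {a..b} \<subseteq> B" if "{a..b} \<subseteq> A \<union> B" for a b
  proof -
    have "p \<notin> {a..b}" using that A B by auto
    then have "b < p \<or> p < a" by auto
    then show ?thesis using that A B by fastforce
  qed
  have disj: "A \<inter> B = {}" using A B by fastforce
  have *: "J \<in> components (A \<union> B) \<longleftrightarrow> J \<in> components A \<or> J \<in> components B" for J
  proof (cases "\<exists>a b. J = {a..b} \<and> J \<noteq> {}")
    case True
    then obtain a b where J: "J = {a..b}" "J \<noteq> {}" by blast
    define maximal where "maximal S \<longleftrightarrow> (\<forall>c d. J \<subseteq> {c..d} \<and> {c..d} \<subseteq> S \<longrightarrow> {c..d} = J)" for S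
    have comp: "J \<in> components S \<longleftrightarrow> J \<subseteq> S \<and> maximal S" for S
      using J unfolding components_def maximal_def by auto
    have "maximal (A \<union> B) \<longleftrightarrow> maximal A" if "J \<subseteq> A"
      unfolding maximal_def using side disj that J(2) by blast
    moreover have "maximal (A \<union> B) \<longleftrightarrow> maximal B" if "J \<subseteq> B"
      unfolding maximal_def using side disj that J(2) by blast
    moreover have "J \<subseteq> A \<union> B \<longleftrightarrow> J \<subseteq> A \<or> J \<subseteq> B"
      using side[of a b] J(1) by blast
    ultimately show ?thesis
      unfolding comp by blast
  qed (auto simp: components_def)
  then show ?thesis by blast
qed

lemma components_interval: "components {a..<b} = (if a < b then {{a..<b}} else {})"
proof (cases "a < b")
  case True
  then have e: "{a..<b} = {a..b - 1}" by auto
  show ?thesis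
    using True unfolding e components_def by auto
qed (auto simp: components_def)

lemma components_inner_Cons:
  "components (inner s (k # ns)) = (if 2 \<le> k then {{Suc s..<s + k}} else {}) \<union> components (inner (s + k) ns)"
proof (cases "2 \<le> k")
  case True
  have "components ({Suc s..<s + k} \<union> inner (s + k) ns) = components {Suc s..<s + k} \<union> components (inner (s + k) ns)"
    by (rule components_Un[of _ "s + k"]) (use inner_subset[of "s + k" ns] in auto)
  then show ?thesis using True by (simp add: components_interval)
qed simp

lemma components_subset: "J \<in> components I \<Longrightarrow> J \<subseteq> I \<and> J \<noteq> {}"
  by (simp add: components_def)

lemma finite_components_inner: "finite (components (inner s ns))"
proof (induction ns arbitrary: s)
  case Nil
  show ?case by (rule finite_subset[of _ "{}"]) (auto simp: components_def)
next
  case (Cons k ns)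
  then show ?case by (simp add: components_inner_Cons del: inner.simps)
qed

lemma half_size_block: "half_size {Suc s..<s + k} = k div 2" if "2 \<le> k"
  using that by (simp add: half_size_def)

lemma new_component: "{Suc s..<s + k} \<notin> components (inner (s + k) ns)" if "2 \<le> k"
proof
  assume "{Suc s..<s + k} \<in> components (inner (s + k) ns)"
  then have "{Suc s..<s + k} \<subseteq> {s + k<..}" using components_subset inner_subset[of "s + k" ns] by fastforce
  moreover have "Suc s \<in> {Suc s..<s + k}" using that by simp
  ultimately have "Suc s \<in> {s + k<..}" by blast
  then show False using that by simp
qed

lemma m_idx_inner: "m_idx (inner s ns) = (\<Sum>k\<leftarrow>ns. k div 2)"
proof (induction ns arbitrary: s)
  case Nil
  have "components {} = {}" by (auto simp: components_def)
  then show ?case by (simp add: m_idx_def)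
next
  case (Cons k ns)
  then show ?case
    using finite_components_inner[of "s + k" ns] new_component[of k s ns]
    by (auto simp: m_idx_def components_inner_Cons half_size_block simp del: inner.simps)
qed

lemma prod_qfact_inner:
  "(\<Prod>J\<in>components (inner s ns). qfact (half_size J) q) = (\<Prod>k\<leftarrow>ns. qfact (k div 2) q)"
proof (induction ns arbitrary: s)
  case Nil
  have "components {} = {}" by (auto simp: components_def)
  then show ?case by simp
next
  case (Cons k ns)
  show ?case
  proof (cases "2 \<le> k")
    case True
    then show ?thesis
      using Cons finite_components_inner[of "s + k" ns] new_component[of k s ns]
      by (simp add: components_inner_Cons half_size_block del: inner.simps)
  next
    \<comment> \<open>Such a block forms no component; this is consistent because its factor is
      \<open>qfact 0 q = 1\<close>.\<close>
    case False
    then have "k div 2 = 0" by simp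
    then show ?thesis using Cons False by (simp add: components_inner_Cons qfact_def del: inner.simps)
  qed
qed

lemma C_idx_inner:
  "C_idx (inner s ns) x = qfact (\<Sum>k\<leftarrow>ns. k div 2) (x\<^sup>2) / (\<Prod>k\<leftarrow>ns. qfact (k div 2) (x\<^sup>2))"
  by (simp add: C_idx_def qmultinomial_def m_idx_inner prod_qfact_inner)

lemma components_prefix:
  "components ({0..<b} \<union> inner b ns) = (if 0 < b then {{0..<b}} else {}) \<union> components (inner b ns)"
proof -
  have "components ({0..<b} \<union> inner b ns) = components {0..<b} \<union> components (inner b ns)"
    by (rule components_Un[of _ b]) (use inner_subset[of b ns] in auto)
  then show ?thesis by (simp add: components_interval)
qed

lemma comp0_prefix: "comp0 ({0..<b} \<union> inner b ns) = {0..<b}"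
proof -
  have "0 \<notin> J" if "J \<in> components (inner b ns)" for J
    using components_subset[OF that] inner_subset[of b ns] by auto
  then show ?thesis
    unfolding comp0_def components_prefix by auto
qed

text \<open>The component of 0 has \<open>b\<close> elements, whereas an ordinary block of size
  \<open>b\<close> gives only \<open>b - 1\<close>; hence \<open>(b + 1) div 2\<close> here against
  \<open>b div 2\<close> in \<open>m_idx_inner\<close>.\<close>

lemma m_idx_prefix: "m_idx ({0..<b} \<union> inner b ns) = (b + 1) div 2 + (\<Sum>k\<leftarrow>ns. k div 2)"
proof -
  have "{0..<b} \<notin> components (inner b ns)" if "0 < b"
  proof
    assume "{0..<b} \<in> components (inner b ns)"
    then have "{0..<b} \<subseteq> {b<..}" using components_subset inner_subset[of b ns] by fastforce
    moreover have "0 \<in> {0..<b}" using that by simp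
    ultimately have "0 \<in> {b<..}" by blast
    then show False by simp
  qed
  then show ?thesis
    using finite_components_inner[of b ns]
    by (cases "0 < b") (auto simp: m_idx_def components_prefix m_idx_inner[unfolded m_idx_def]
        half_size_def[of "{0..<b}"])
qed

lemma ex_prefix_inner:
  assumes "I \<subset> {0..n - 1}" "0 < n"
  shows "\<exists>b ns. b < n \<and> sum_list ns = n - b \<and> I = {0..<b} \<union> inner b ns"
proof -
  \<comment> \<open>The least gap, which exists since \<open>I\<close> is a proper subset;
    \<open>b\<close> is the size of the component of 0.\<close>
  define b where "b = (LEAST i. i \<notin> I)"
  obtain i where i: "i \<in> {0..n - 1}" "i \<notin> I" using assms(1) by blast
  then have b: "b \<notin> I" "b < n"
    unfolding b_def using LeastI[of "\<lambda>i. i \<notin> I" i] Least_le[of "\<lambda>i. i \<notin> I" i] assms(2) by auto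
  have low: "i \<in> I" if "i < b" for i
    using that not_less_Least[of i "\<lambda>i. i \<notin> I"] by (simp add: b_def)
  have "I \<inter> {b<..} \<subseteq> {b<..<b + (n - b)}" using assms by auto
  from ex_inner[OF this] obtain ns where "sum_list ns = n - b" "I \<inter> {b<..} = inner b ns" by blast
  moreover have "I = {0..<b} \<union> (I \<inter> {b<..})"
    using low b(1) by (auto simp: not_less order.order_iff_strict)
  ultimately show ?thesis using b(2) by (intro exI[of _ b] exI[of _ ns]) simp
qed

lemma indet_power_neq_1:
  assumes "0 < k"
  shows "indet ^ k \<noteq> 1"
proof
  assume "indet ^ k = 1"
  moreover have "indet ^ k = to_fract ([:0, 1:] ^ k)"
    by (induction k) (simp_all add: indet_def del: mult_pCons_left)
  ultimately have "to_fract ([:0, 1:] ^ k) = to_fract (1 :: int poly)" by simp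
  then have "[:0, 1:] ^ k = (1 :: int poly)" by (simp only: to_fract_eq_iff)
  then have "degree ([:0, 1:] ^ k :: int poly) = 0" by simp
  moreover have "degree ([:0, 1:] ^ k :: int poly) = k" by (simp add: degree_power_eq)
  ultimately show False using assms by simp
qed

text \<open>The sums over signed words equal twice the type D sum, so 2 has to be cancelled at the
  end.\<close>

lemma two_neq_0_fract: "(2 :: int poly fract) \<noteq> 0"
proof
  assume "(2 :: int poly fract) = 0"
  then have "to_fract (1 + 1 :: int poly) = 0"
    by (simp only: to_fract_add to_fract_1 one_add_one)
  then show False by simp
qed

section \<open>Assembling the closed formula\<close>

context
  fixes x :: "'a::field"
  assumes power_neq_1: "\<And>k. 0 < k \<Longrightarrow> x ^ k \<noteq> 1"
begin

lemma one_plus_power_neq_0: "0 < k \<Longrightarrow> 1 + x ^ k \<noteq> 0"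
proof
  assume "0 < k" "1 + x ^ k = 0"
  then have "x ^ k = - 1" by (simp add: eq_neg_iff_add_eq_0 add.commute)
  then have "x ^ (k * 2) = 1" by (simp add: power_mult)
  then show False using power_neq_1[of "k * 2"] \<open>0 < k\<close> by simp
qed

lemma qfact_neq_0: "qfact N (x\<^sup>2) \<noteq> 0"
  using power_neq_1 by (auto simp: qfact_def simp flip: power_mult)

lemma prod_qfact_neq_0: "(\<Prod>k\<leftarrow>ns. qfact (k div 2) (x\<^sup>2)) \<noteq> 0"
  using qfact_neq_0 by (induction ns) auto

lemma divide_form: "d \<noteq> 0 \<Longrightarrow> d * l = p * r \<Longrightarrow> l = p / d * r" for d l p r :: 'a
  by (simp add: field_simps)

lemma gen_no_prefix:
  assumes "sum_list ns = n" "2 \<le> n"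
  shows "gen x 0 ns (alt True n) = 2 * (C_idx (inner 0 ns) x *
    (\<Prod>i = 2..n. rank_factor x i) * (\<Prod>j = 2 * m_idx (inner 0 ns) + 2..n. rank_factor x j))"
proof -
  define M t where "M = (\<Sum>k\<leftarrow>ns. k div 2)" "t = (\<Sum>k\<leftarrow>ns. k mod 2)"
  let ?P = "\<Prod>k\<leftarrow>ns. qfact (k div 2) (x\<^sup>2)"
  have q0: "qfact 0 (x\<^sup>2) = 1" by (simp add: qfact_def)
  have n: "n = 2 * M + t"
    unfolding M_t_def assms(1)[symmetric] by (induction ns) (auto simp: algebra_simps)
  have "?P * gen x 0 ns (alt True n) = gen0 x 0 (replicate M 2 @ replicate t 1)"
    using gen0_normalize[OF power_neq_1, of ns 0] assms(1)
    by (simp add: gen0_def M_t_def)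
  also have "\<dots> = 2 * (qfact M (x\<^sup>2) * (\<Prod>i = 2..n. rank_factor x i) *
      (\<Prod>j = 2 * M + 2..n. rank_factor x j))"
  proof (cases t)
    \<comment> \<open>For \<open>h = 0\<close> the exceptional numerator
      \<open>1 + x^0 + 2 * x^M\<close> is \<open>2 * (1 + x^M)\<close>, so the quotient collapses to
      2.\<close>
    case 0
    then have M: "0 < M" using n assms(2) by simp
    have "(1 + x ^ M) * gen0 x 0 (replicate M 2) =
        (2 * (1 + x ^ M)) * (qfact M (x\<^sup>2) * (\<Prod>i = 2..n. rank_factor x i))"
      using gen0_even_pairs[OF power_neq_1, of n M 0 M, unfolded q0 mult_0_right add_0] n 0 M
      by (simp add: distrib_left)
    moreover have "2 * (1 + x ^ M) / (1 + x ^ M) = 2"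
      using one_plus_power_neq_0[OF M] by (rule nonzero_mult_div_cancel_right)
    ultimately show ?thesis
      using divide_form[OF one_plus_power_neq_0[OF M]] n 0 by fastforce
  next
    \<comment> \<open>Here the 2 is the factor \<open>1 + x^(2*h)\<close> at
      \<open>h = 0\<close>.\<close>
    case (Suc u)
    have "n = 2 * 0 + 2 * M + Suc u" using n Suc by simp
    from gen0_even_singleton[OF power_neq_1 this]
    show ?thesis
      unfolding Suc by (simp only: q0 mult_0_right add_0 power_0 one_add_one mult_1)
  qed
  finally show ?thesis
    using prod_qfact_neq_0[of ns]
    by (simp add: C_idx_inner m_idx_inner field_simps flip: M_t_def)
qed

lemma gen_prefix:
  assumes "b + sum_list ns = n" "2 \<le> b" "b < n"
  shows "gen x b ns (alt True n) =
    f_factor n ({0..<b} \<union> inner b ns) x * C_idx (inner 0 (b # ns)) x *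
    (\<Prod>i = 2 * ((b + 2) div 2)..n. rank_factor x i) *
    (\<Prod>j = 2 * m_idx (inner 0 (b # ns)) + 2..n. rank_factor x j)"
proof -
  define m t where "m = (\<Sum>k\<leftarrow>ns. k div 2)" "t = (\<Sum>k\<leftarrow>ns. k mod 2)"
  define h where "h = b div 2"
  let ?P = "\<Prod>k\<leftarrow>ns. qfact (k div 2) (x\<^sup>2)"
  define Q where "Q = (\<Prod>i = 2 * h + 2..n. rank_factor x i) * (\<Prod>j = 2 * (h + m) + 2..n. rank_factor x j)"
  have "sum_list ns = 2 * m + t"
    unfolding m_t_def by (induction ns) (auto simp: algebra_simps)
  then have n: "n = b + 2 * m + t" using assms(1) by simp
  have "?P * gen x b ns (alt True n) = gen0 x b (replicate m 2 @ replicate t 1)"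
    using gen0_normalize[OF power_neq_1, of ns b] assms(1)
    by (simp add: gen0_def m_t_def)
  moreover have "qfact h (x\<^sup>2) * gen0 x b (replicate m 2 @ replicate t 1) =
      f_factor n ({0..<b} \<union> inner b ns) x * (qfact (h + m) (x\<^sup>2) * Q)"
  proof (cases "odd b")
    case True
    then have b: "b = Suc (2 * h)" by (simp add: h_def)
    show ?thesis
      using gen0_odd[OF power_neq_1, of n h m t] n b True
      by (simp add: f_factor_def comp0_prefix Q_def mult.assoc)
  next
    case even: False
    then have b: "b = 2 * h" by (simp add: h_def)
    have m: "m_idx ({0..<b} \<union> inner b ns) = h + m"
      using even by (simp add: m_idx_prefix h_def m_t_def)
    show ?thesis
    proof (cases t)
      \<comment> \<open>For even \<open>b\<close>, \<open>n = 2 * (h + m) + t\<close> and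
        \<open>m_idx\<close> of the set is \<open>h + m\<close>; so \<open>t = 0\<close> is exactly
        the condition \<open>n = 2 * m_I\<close> of the exceptional case.\<close>
      case 0
      then have pos: "0 < m" "n = 2 * (h + m)" using n assms(3) b by auto
      then have "f_factor n ({0..<b} \<union> inner b ns) x = (1 + x ^ (2 * h) + 2 * x ^ (h + m)) / (1 + x ^ (h + m))"
        using m even assms(2) by (simp add: f_factor_def comp0_prefix flip: b)
      moreover have "Q = (\<Prod>i = 2 * h + 2..n. rank_factor x i)" using pos by (simp add: Q_def)
      ultimately show ?thesis
        using divide_form[OF one_plus_power_neq_0 gen0_even_pairs[OF power_neq_1 pos(2) refl pos(1)]] pos(1) 0
        by (simp add: b)
    next
      case (Suc u)
      then have "f_factor n ({0..<b} \<union> inner b ns) x = 1 + x ^ (2 * h)"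
        using m even assms(2) n b by (simp add: f_factor_def comp0_prefix)
      then show ?thesis
        using gen0_even_singleton[OF power_neq_1, of n h m u] n b Suc by (simp add: Q_def mult.assoc)
    qed
  qed
  ultimately have G: "qfact h (x\<^sup>2) * ?P * gen x b ns (alt True n) =
      f_factor n ({0..<b} \<union> inner b ns) x * (qfact (h + m) (x\<^sup>2) * Q)"
    by (simp add: mult.assoc)
  have C: "C_idx (inner 0 (b # ns)) x = qfact (h + m) (x\<^sup>2) / (qfact h (x\<^sup>2) * ?P)"
    "m_idx (inner 0 (b # ns)) = h + m" "2 * ((b + 2) div 2) = 2 * h + 2"
    by (simp_all add: C_idx_inner m_idx_inner h_def m_t_def del: inner.simps)
  show ?thesis
    unfolding C using G prod_qfact_neq_0[of ns] qfact_neq_0[of h] by (simp add: Q_def field_simps)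
qed

end

theorem theorem5p10:
  fixes n :: nat and I :: "nat set" and x :: "int poly fract"
  assumes "n \<ge> 2" and "I \<subset> {0..n - 1}" and "x = indet"
  shows "D_gen n I x =
           f_factor n I x * C_idx (tilde I) x *
           (\<Prod>i = 2 * ((card (comp0 I) + 2) div 2)..n. 1 + (- 1) ^ (i - 1) * x ^ (i div 2)) *
           (\<Prod>j = 2 * m_idx (tilde I) + 2..n. 1 + (- 1) ^ (j - 1) * x ^ (j div 2))"
proof -
  have x: "x ^ k \<noteq> 1" if "0 < k" for k
    using indet_power_neq_1[OF that] assms(3) by simp
  have sub: "I \<subseteq> {0..n - 1}" using assms(2) by blast
  obtain b ns where b: "b < n" "sum_list ns = n - b" "I = {0..<b} \<union> inner b ns"
    using ex_prefix_inner[OF assms(2)] assms(1) by auto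
  have c0: "comp0 I = {0..<b}" using comp0_prefix[of b ns] b(3) by simp
  have "2 * D_gen n I x = 2 * (f_factor n I x * C_idx (tilde I) x *
      (\<Prod>i = 2 * ((b + 2) div 2)..n. rank_factor x i) *
      (\<Prod>j = 2 * m_idx (tilde I) + 2..n. rank_factor x j))"
  proof (cases "2 \<le> b")
    \<comment> \<open>Since 1 already lies in \<open>I\<close>, \<open>tilde\<close> only removes 0
      and turns the first component into that of an ordinary block of size \<open>b\<close>.\<close>
    case True
    then have "tilde I = inner 0 (b # ns)"
      using c0 inner_subset[of b ns] by (auto simp: tilde_def b(3))
    then show ?thesis
      using gen_prefix[OF x, of b ns n] two_D_gen[OF assms(1) sub, of x]
        sum_ascent_words_prefix[OF True, of n ns x] b True by simp
  next
    \<comment> \<open>The component of 0 has at most one element. Either 0 is absent, or it is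
      replaced by 1 through the symmetry of \<open>two_D_gen_swap\<close>; both lead to words
      without a type D block.\<close>
    case False
    have "inner b ns \<subseteq> {b<..<n}" using inner_subset[of b ns] b by simp
    moreover have "tilde I = (if b = 0 then I else I - {0} \<union> {1})"
      using c0 by (simp add: tilde_def)
    ultimately have "tilde I \<subseteq> {0<..<0 + n}"
      using b(1) assms(1) by (auto simp: b(3))
    from ex_inner[OF this] obtain ms where ms: "sum_list ms = n" "tilde I = inner 0 ms" by blast
    have "2 * D_gen n I x = (\<Sum>xs\<in>ascent_words n (tilde I). weight x (zip (alt True n) xs))"
    proof (cases "b = 0")
      case True
      then show ?thesis using two_D_gen[OF assms(1) sub, of x] c0 by (simp add: tilde_def)
    next
      case b1: False
      then have "0 \<in> I" "1 \<notin> I" using b(3) \<open>\<not> 2 \<le> b\<close> inner_subset[of b ns] by auto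
      then show ?thesis
        using two_D_gen_swap[OF assms(1) sub, of x] c0 b1 by (simp add: tilde_def)
    qed
    also have "\<dots> = gen x 0 ms (alt True n)"
      using ascent_words_inner[of ms] ms by (simp add: gen_def)
    finally have "2 * D_gen n I x = gen x 0 ms (alt True n)" .
    moreover have "f_factor n I x = 1" "2 * ((b + 2) div 2) = 2"
      using False c0 by (auto simp: f_factor_def)
    ultimately show ?thesis
      using gen_no_prefix[OF x ms(1) assms(1)] ms(2) by simp
  qed
  then show ?thesis
    using two_neq_0_fract c0 by (simp add: rank_factor_def)
qed

end
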